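(* Let $k$ be a field, let $G$ be a finite simple graph without isolated vertices, with nonempty vertex set $V(G)=\{x_1,\dots,x_n\}$ and with $p$ connected components, let $R=k[x_1,\dots,x_n]$, let $I=I(G)\subseteq R$ be the edge ideal of $G$, and let $d=d(G)$ be the diameter of $G$. Then $$\operatorname{depth} R/I^2\ \geq\ \left\lceil \frac{d-3}{3}\right\rceil+p-1 .$$
   Context: Simple graph: no loops and no multiple edges. Vertices of $G$ are identified with the variables of $R$. The edge ideal $I(G)$ is the ideal of $R$ generated by the monomials $x_ix_j$ with $\{x_i,x_j\}\in E(G)$. The diameter of a connected graph is the maximum of the distances $d(u,v)$ (length of a shortest path) over all pairs of vertices; the diameter of a disconnected graph means the maximum of the diameters of its connected components. $\operatorname{depth} R/I^2$ is the maximum length of an $R/I^2$-regular sequence in $\mathfrak m=(x_1,\dots,x_n)$. *)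

theory Defs
  imports
    "Graph_Theory.Graph_Theory"
    "HOL-Library.Poly_Mapping"
    "HOL-Library.Extended_Real"
begin

section \<open>Distances and diameter\<close>

text \<open>A path is given by its list of arcs, so its length is the length of that list.\<close>

definition graph_dist :: "('v, 'e) pre_digraph \<Rightarrow> 'v \<Rightarrow> 'v \<Rightarrow> nat" where
  "graph_dist G u v = (LEAST l. \<exists>p. pre_digraph.apath G u p v \<and> length p = l)"

definition connected_diameter :: "('v, 'e) pre_digraph \<Rightarrow> nat" where
  "connected_diameter G = Max {graph_dist G u v | u v. u \<in> verts G \<and> v \<in> verts G}"

text \<open>
  The arcs of an undirected graph come in pairs of opposite arcs, hence its strongly connected
  components are its connected components. If the graph is connected, it is its only component,
  and the maximum below is over a singleton.
\<close>

definition graph_diameter :: "('v, 'e) pre_digraph \<Rightarrow> nat" where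
  "graph_diameter G = Max (connected_diameter ` pre_digraph.sccs G)"

definition no_isolated_verts :: "'v pair_pre_digraph \<Rightarrow> bool" where
  "no_isolated_verts G \<longleftrightarrow> (\<forall>u \<in> pverts G. \<exists>v. (u, v) \<in> parcs G)"


section \<open>Ideals, regular sequences and depth\<close>

text \<open>Ideals are the submodules of a commutative ring acting on itself by multiplication.\<close>

abbreviation ideal_gen :: "'a::comm_ring_1 set \<Rightarrow> 'a set" where
  "ideal_gen B \<equiv> module.span (*) B"

definition ideal_mult :: "'a::comm_ring_1 set \<Rightarrow> 'a set \<Rightarrow> 'a set" where
  "ideal_mult I J = ideal_gen {a * b | a b. a \<in> I \<and> b \<in> J}"

text \<open>
  For an ideal \<open>J\<close> of \<open>R\<close>, \<open>f\<^sub>1, \<dots>, f\<^sub>r\<close> is a regular sequence on the module \<open>M = R/J\<close> if each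
  \<open>f\<^sub>i\<close> is a nonzerodivisor on \<open>M/(f\<^sub>1, \<dots>, f\<^sub>i\<^sub>-\<^sub>1)M = R/(J + (f\<^sub>1, \<dots>, f\<^sub>i\<^sub>-\<^sub>1))\<close> and
  \<open>M/(f\<^sub>1, \<dots>, f\<^sub>r)M = R/(J + (f\<^sub>1, \<dots>, f\<^sub>r))\<close> is nonzero. Cosets are handled through representatives.
\<close>

definition regular_seq_quot :: "'a::comm_ring_1 set \<Rightarrow> 'a list \<Rightarrow> bool" where
  "regular_seq_quot J fs \<longleftrightarrow>
     (\<forall>i < length fs. \<forall>g. fs ! i * g \<in> ideal_gen (J \<union> set (take i fs)) \<longrightarrow>
                           g \<in> ideal_gen (J \<union> set (take i fs))) \<and>
     ideal_gen (J \<union> set fs) \<noteq> UNIV"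

text \<open>The depth of \<open>R/J\<close> with respect to the ideal \<open>m\<close>.\<close>

definition depth_quot :: "'a::comm_ring_1 set \<Rightarrow> 'a set \<Rightarrow> enat" where
  "depth_quot m J = Sup {enat (length fs) | fs. set fs \<subseteq> m \<and> regular_seq_quot J fs}"


section \<open>Polynomial rings and edge ideals\<close>

text \<open>
  The polynomial ring over \<open>'k\<close> whose variables are the elements of \<open>'v\<close>: finitely supported
  maps from monomials (finitely supported exponent vectors) to coefficients.
\<close>

type_synonym ('v, 'k) mpolynomial = "('v \<Rightarrow>\<^sub>0 nat) \<Rightarrow>\<^sub>0 'k"

definition var :: "'v \<Rightarrow> ('v, 'k::comm_ring_1) mpolynomial" where
  "var v = Poly_Mapping.single (Poly_Mapping.single v 1) 1"

definition irrelevant_ideal :: "('v, 'k::comm_ring_1) mpolynomial set" where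
  "irrelevant_ideal = ideal_gen (range var)"

definition edge_ideal :: "'v pair_pre_digraph \<Rightarrow> ('v, 'k::comm_ring_1) mpolynomial set" where
  "edge_ideal G = ideal_gen {var u * var v | u v. (u, v) \<in> parcs G}"

end

theory Submission
  imports Defs
begin

text \<open>
  The exact sequence \<open>0 \<rightarrow> R/(J : m) \<rightarrow> R/J \<rightarrow> R/(J + (m)) \<rightarrow> 0\<close> transfers a regular sequence from the
  two outer modules to \<open>R/J\<close>, provided that the \<^emph>\<open>same\<close> sequence is regular on both. Splitting
  repeatedly with monomials \<open>m\<close> reduces a monomial ideal to ideals \<open>(x\<^sub>w | w \<in> W)\<close>, and the elementary
  symmetric polynomials \<open>e\<^sub>1, \<dots>, e\<^sub>r\<close> in all variables are a regular sequence modulo each such ideal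
  with at least \<open>r\<close> variables outside \<open>W\<close>. Hence no homological depth lemma is needed.

  For an edge ideal plus some variables, the splitting shows that \<open>r\<close> vertices with pairwise disjoint
  closed neighbourhoods give depth at least \<open>r\<close>. To pass from \<open>I\<^sup>2\<close> to \<open>I\<close>, the edges are added to \<open>I\<^sup>2\<close>
  one by one. The colon ideal by the edge \<open>xy\<close> consists of \<open>I\<close>, the products \<open>x\<^sub>u x\<^sub>v\<close> with \<open>u \<in> N(x)\<close>
  and \<open>v \<in> N(y)\<close>, and some variables of \<open>N(x) \<union> N(y)\<close>, so the packing only has to avoid a set whose
  elements have pairwise distance at most 3. Taking every third vertex of a geodesic of length \<open>d\<close>
  outside this set, and one vertex of each further component, gives the bound.
\<close>

section \<open>Weakly regular sequences\<close>

interpretation ideal: module "(*) :: 'a::comm_ring_1 \<Rightarrow> 'a \<Rightarrow> 'a"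
  by unfold_locales (simp_all add: algebra_simps)

definition nzd_mod :: "'a::comm_ring_1 set \<Rightarrow> 'a \<Rightarrow> bool" where
  "nzd_mod J f \<longleftrightarrow> (\<forall>g. f * g \<in> J \<longrightarrow> g \<in> J)"

lemma nzd_modI: "(\<And>g. f * g \<in> J \<Longrightarrow> g \<in> J) \<Longrightarrow> nzd_mod J f"
  unfolding nzd_mod_def by blast

lemma nzd_modD: "nzd_mod J f \<Longrightarrow> f * g \<in> J \<Longrightarrow> g \<in> J"
  unfolding nzd_mod_def by blast

text \<open>Recursing on the ideal, instead of on prefixes of the list, turns the later arguments
  into inductions on the list with \<open>J\<close> arbitrary. Properness of the final ideal is
  treated apart, in \<open>depth_quot_ge\<close>.\<close>

primrec weakly_regular :: "'a::comm_ring_1 set \<Rightarrow> 'a list \<Rightarrow> bool" where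
  "weakly_regular J [] \<longleftrightarrow> True"
| "weakly_regular J (f # fs) \<longleftrightarrow> nzd_mod J f \<and> weakly_regular (ideal_gen (insert f J)) fs"

declare ideal.scale_scale [simp del] \<comment> \<open>loops with associativity: scaling is multiplication\<close>

lemma ideal_mult_left: "ideal.subspace J \<Longrightarrow> a \<in> J \<Longrightarrow> b * a \<in> J"
  by (rule ideal.subspace_scale)

lemma ideal_mult_right: "ideal.subspace J \<Longrightarrow> a \<in> J \<Longrightarrow> a * b \<in> J"
  by (metis ideal.subspace_scale mult.commute)

lemma ideal_gen_subspace: "ideal.subspace J \<Longrightarrow> ideal_gen J = J"
  by (simp add: ideal.span_eq_iff)

lemma mem_ideal_gen_insert:
  "ideal.subspace J \<Longrightarrow> x \<in> ideal_gen (insert f J) \<longleftrightarrow> (\<exists>h. x - f * h \<in> J)"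
  by (simp add: ideal.span_insert ideal_gen_subspace mult.commute)

lemma ideal_gen_insert_span: "ideal_gen (insert f (ideal_gen J)) = ideal_gen (insert f J)"
  by (simp add: ideal.span_insert ideal.span_span)

lemma ideal_gen_Un_span: "ideal_gen (ideal_gen J \<union> B) = ideal_gen (J \<union> B)"
  by (simp add: ideal.span_Un ideal.span_span)

lemma weakly_regular_append:
  "weakly_regular J (fs @ gs) \<Longrightarrow> weakly_regular J fs"
  by (induction fs arbitrary: J) auto

lemma weakly_regular_snoc:
  "ideal.subspace J \<Longrightarrow>
   weakly_regular J (fs @ [g]) \<longleftrightarrow> weakly_regular J fs \<and> nzd_mod (ideal_gen (J \<union> set fs)) g"
proof (induction fs arbitrary: J)
  case Nil
  then show ?case by (simp add: ideal_gen_subspace)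
next
  case (Cons f fs)
  then show ?case
    using Cons.IH[of "ideal_gen (insert f J)"] by (simp add: ideal_gen_Un_span)
qed

lemma regular_seq_quotI:
  assumes "weakly_regular (ideal_gen J) fs" and "ideal_gen (J \<union> set fs) \<noteq> UNIV"
  shows "regular_seq_quot J fs"
proof -
  have "\<forall>i < length fs. nzd_mod (ideal_gen (J \<union> set (take i fs))) (fs ! i)"
    using assms(1)
  proof (induction fs arbitrary: J)
    case (Cons f fs)
    then have "nzd_mod (ideal_gen J) f" and "weakly_regular (ideal_gen (insert f J)) fs"
      by (simp_all add: ideal_gen_insert_span)
    from \<open>nzd_mod (ideal_gen J) f\<close> Cons.IH[OF this(2)] show ?case
      by (simp add: All_less_Suc2)
  qed simp
  with assms(2) show ?thesis
    unfolding regular_seq_quot_def nzd_mod_def by blast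
qed

text \<open>
  This is the exact sequence \<open>0 \<rightarrow> R/(J : m) \<rightarrow> R/J \<rightarrow> R/(J + (m)) \<rightarrow> 0\<close> with \<open>K = J : m\<close>.
\<close>

lemma weakly_regular_colon:
  assumes "ideal.subspace J" and "ideal.subspace K" and "\<And>g. g \<in> K \<longleftrightarrow> m * g \<in> J"
    and "weakly_regular K fs" and "weakly_regular (ideal_gen (insert m J)) fs"
  shows "weakly_regular J fs"
  using assms
proof (induction fs arbitrary: J K)
  case (Cons f fs)
  let ?J = "ideal_gen (insert f J)" and ?K = "ideal_gen (insert f K)"
  note J = \<open>ideal.subspace J\<close> and K = \<open>ideal.subspace K\<close> and colon = Cons.prems(3)
  have fK: "nzd_mod K f" and fm: "nzd_mod (ideal_gen (insert m J)) f"
    using Cons.prems by simp_all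
  \<comment> \<open>Diagram chase: regularity modulo \<open>J + (m)\<close> writes \<open>g\<close>
    as \<open>m * h\<close> modulo \<open>J\<close>; then \<open>f * h \<in> K\<close>, and
    regularity modulo \<open>K\<close> gives \<open>h \<in> K\<close>.\<close>
  have "g \<in> J" if "f * g \<in> J" for g
  proof -
    have "f * g \<in> ideal_gen (insert m J)"
      using that by (simp add: ideal.span_base)
    then have "g \<in> ideal_gen (insert m J)"
      by (rule nzd_modD[OF fm])
    then obtain h where h: "g - m * h \<in> J"
      using mem_ideal_gen_insert[OF J] by blast
    have "f * g - f * (g - m * h) \<in> J"
      by (rule ideal.subspace_diff[OF J that ideal_mult_left[OF J h]])
    moreover have "f * g - f * (g - m * h) = m * (f * h)"
      by (simp add: algebra_simps)
    ultimately have "f * h \<in> K"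
      using colon[of "f * h"] by metis
    then have "h \<in> K"
      by (rule nzd_modD[OF fK])
    then have "m * h \<in> J"
      by (rule colon[THEN iffD1])
    with h show ?thesis
      by (metis J diff_add_cancel ideal.subspace_add)
  qed
  then have fJ: "nzd_mod J f"
    by (rule nzd_modI)
  \<comment> \<open>The sequence stays exact after killing \<open>f\<close>, because
    \<open>f\<close> is regular modulo \<open>J + (m)\<close>; so the induction can continue with
    \<open>?J\<close> and \<open>?K\<close>.\<close>
  have colon': "g \<in> ?K \<longleftrightarrow> m * g \<in> ?J" for g
  proof
    assume "g \<in> ?K"
    then obtain h where "g - f * h \<in> K"
      using mem_ideal_gen_insert[OF K] by blast
    then have "m * (g - f * h) \<in> J"
      by (rule colon[THEN iffD1])
    also have "m * (g - f * h) = m * g - f * (m * h)"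
      by (simp add: algebra_simps)
    finally have "m * g - f * (m * h) \<in> J" .
    then show "m * g \<in> ?J"
      using mem_ideal_gen_insert[OF J] by blast
  next
    assume "m * g \<in> ?J"
    then obtain h where h: "m * g - f * h \<in> J"
      using mem_ideal_gen_insert[OF J] by blast
    then have "- (m * g - f * h) \<in> J"
      by (rule ideal.subspace_neg[OF J])
    then have "f * h - m * g \<in> J"
      by simp
    then have "f * h \<in> ideal_gen (insert m J)"
      using mem_ideal_gen_insert[OF J] by blast
    then have "h \<in> ideal_gen (insert m J)"
      by (rule nzd_modD[OF fm])
    then obtain h' where h': "h - m * h' \<in> J"
      using mem_ideal_gen_insert[OF J] by blast
    have "(m * g - f * h) + f * (h - m * h') \<in> J"
      by (rule ideal.subspace_add[OF J h ideal_mult_left[OF J h']])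
    also have "(m * g - f * h) + f * (h - m * h') = m * (g - f * h')"
      by (simp add: algebra_simps)
    finally have "g - f * h' \<in> K"
      by (subst colon)
    then show "g \<in> ?K"
      using mem_ideal_gen_insert[OF K] by blast
  qed
  have "weakly_regular (ideal_gen (insert m ?J)) fs"
    using Cons.prems(5) by (simp add: ideal_gen_insert_span insert_commute)
  moreover have "weakly_regular ?K fs"
    using Cons.prems(4) by simp
  ultimately have "weakly_regular ?J fs"
    by (rule Cons.IH[OF ideal.subspace_span ideal.subspace_span colon', rotated])
  with fJ show ?case
    by (rule weakly_regular.simps(2)[THEN iffD2, OF conjI])
qed (rule weakly_regular.simps(1)[THEN iffD2, OF TrueI])

text \<open>One half of the exchange of two regular elements, iterated along the list:
  \<open>y\<close> moves past each \<open>f\<close>. The other half, regularity of \<open>f\<close>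
  modulo \<open>J\<close>, uses the grading and is \<open>nzd_mod_lift\<close>.\<close>

lemma nzd_mod_weakly_regular:
  assumes "ideal.subspace J" and "nzd_mod J y" and "weakly_regular (ideal_gen (insert y J)) fs"
  shows "nzd_mod (ideal_gen (J \<union> set fs)) y"
  using assms
proof (induction fs arbitrary: J)
  case Nil
  show ?case
    unfolding list.set Un_empty_right ideal_gen_subspace[OF Nil(1)] by (rule Nil(2))
next
  case (Cons f fs)
  note J = \<open>ideal.subspace J\<close>
  have fy: "nzd_mod (ideal_gen (insert y J)) f"
    using Cons.prems(3) by simp
  have "a \<in> ideal_gen (insert f J)" if ya: "y * a \<in> ideal_gen (insert f J)" for a
  proof -
    obtain b where b: "y * a - f * b \<in> J"
      using ya mem_ideal_gen_insert[OF J] by blast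
    then have "f * b - y * a \<in> J"
      using ideal.subspace_neg[OF J b] by simp
    then have "f * b \<in> ideal_gen (insert y J)"
      using mem_ideal_gen_insert[OF J] by blast
    with fy have "b \<in> ideal_gen (insert y J)"
      by (rule nzd_modD)
    then obtain c where c: "b - y * c \<in> J"
      using mem_ideal_gen_insert[OF J] by blast
    have "(y * a - f * b) + f * (b - y * c) \<in> J"
      by (rule ideal.subspace_add[OF J b ideal_mult_left[OF J c]])
    also have "(y * a - f * b) + f * (b - y * c) = y * (a - f * c)"
      by (simp add: algebra_simps)
    finally have "a - f * c \<in> J"
      by (rule nzd_modD[OF Cons.prems(2)])
    then show ?thesis
      using mem_ideal_gen_insert[OF J] by blast
  qed
  then have "nzd_mod (ideal_gen (insert f J)) y"
    by (rule nzd_modI)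
  moreover have "weakly_regular (ideal_gen (insert y (ideal_gen (insert f J)))) fs"
    using Cons.prems(3) by (simp add: ideal_gen_insert_span insert_commute)
  ultimately have "nzd_mod (ideal_gen (ideal_gen (insert f J) \<union> set fs)) y"
    by (rule Cons.IH[OF ideal.subspace_span])
  then show ?case
    by (simp add: ideal_gen_Un_span)
qed

section \<open>Monomial ideals\<close>

abbreviation lookup :: "('a \<Rightarrow>\<^sub>0 'b::zero) \<Rightarrow> 'a \<Rightarrow> 'b" where
  "lookup \<equiv> Poly_Mapping.lookup"

abbreviation keys :: "('a \<Rightarrow>\<^sub>0 'b::zero) \<Rightarrow> 'a set" where
  "keys \<equiv> Poly_Mapping.keys"

abbreviation single :: "'a \<Rightarrow> 'b \<Rightarrow> 'a \<Rightarrow>\<^sub>0 'b::zero" where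
  "single \<equiv> Poly_Mapping.single"

text \<open>The degree is the constant 0 if there are infinitely many variables.\<close>

definition mon_deg :: "('v \<Rightarrow>\<^sub>0 nat) \<Rightarrow> nat" where
  "mon_deg e = (\<Sum>v\<in>UNIV. lookup e v)"

definition homogeneous :: "nat \<Rightarrow> ('v, 'k::comm_ring_1) mpolynomial \<Rightarrow> bool" where
  "homogeneous n f \<longleftrightarrow> (\<forall>e \<in> keys f. mon_deg e = n)"

lift_definition restrict_keys :: "'a set \<Rightarrow> ('a \<Rightarrow>\<^sub>0 'b::zero) \<Rightarrow> 'a \<Rightarrow>\<^sub>0 'b" is
  "\<lambda>U f e. if e \<in> U then f e else 0"
  by (rule finite_subset) auto

text \<open>Monomial ideals are represented by their exponent sets, so that adding a monomial or
  taking the colon by one becomes a set operation.\<close>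

definition mon_ideal :: "('v \<Rightarrow>\<^sub>0 nat) set \<Rightarrow> ('v, 'k::comm_ring_1) mpolynomial set" where
  "mon_ideal U = {p. keys p \<subseteq> U}"

definition up_closed :: "('v \<Rightarrow>\<^sub>0 nat) set \<Rightarrow> bool" where
  "up_closed U \<longleftrightarrow> (\<forall>e \<in> U. \<forall>e'. e + e' \<in> U)"

definition indicator_mon :: "'v set \<Rightarrow> 'v \<Rightarrow>\<^sub>0 nat" where
  "indicator_mon A = (\<Sum>v\<in>A. single v 1)"

definition elem_sym :: "nat \<Rightarrow> ('v, 'k::comm_ring_1) mpolynomial" where
  "elem_sym j = (\<Sum>A | card A = j. single (indicator_mon A) 1)"

lemma mon_deg_add: "mon_deg (a + b) = mon_deg a + mon_deg b"
  by (simp add: mon_deg_def lookup_add sum.distrib)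

lemma lookup_indicator_mon:
  "finite A \<Longrightarrow> lookup (indicator_mon A) v = (if v \<in> A then 1 else 0)"
  by (simp add: indicator_mon_def lookup_sum lookup_single when_def)

lemma mon_deg_indicator_mon:
  "finite (UNIV :: 'v set) \<Longrightarrow> mon_deg (indicator_mon (A :: 'v set)) = card A"
  using finite_subset[OF subset_UNIV, of A] by (simp add: mon_deg_def lookup_indicator_mon sum.If_cases)

lemma mon_deg_single:
  "finite (UNIV :: 'v set) \<Longrightarrow> mon_deg (single (v :: 'v) n) = n"
  by (simp add: mon_deg_def lookup_single when_def)

lemma keys_restrict_keys: "keys (restrict_keys U p) = keys p \<inter> U"
  by transfer auto

lemma restrict_keys_add: "restrict_keys U (p + q) = restrict_keys U p + restrict_keys U q"
  for p q :: "'a \<Rightarrow>\<^sub>0 'b::monoid_add"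
  by transfer auto

lemma restrict_keys_id: "keys p \<subseteq> U \<Longrightarrow> restrict_keys U p = p"
  by transfer (auto simp: fun_eq_iff)

lemma restrict_keys_0: "keys p \<inter> U = {} \<Longrightarrow> restrict_keys U p = 0"
  by transfer (auto simp: fun_eq_iff)

lemma restrict_keys_compl: "restrict_keys U p + restrict_keys (- U) p = p"
  for p :: "'a \<Rightarrow>\<^sub>0 'b::monoid_add"
  by transfer (auto simp: fun_eq_iff)

lemma keys_single_mult:
  "keys (single e (1 :: 'k::comm_ring_1) * p) = (\<lambda>e'. e + e') ` keys p"
  for e :: "'v \<Rightarrow>\<^sub>0 nat"
proof -
  have *: "lookup (single e 1 * p) (e + e') = lookup p e'" for e'
    by (simp add: lookup_mult lookup_single when_mult)
  show ?thesis
  proof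
    show "keys (single e 1 * p) \<subseteq> (\<lambda>e'. e + e') ` keys p"
      using keys_mult[of "single e 1" p] by (auto split: if_splits)
    show "(\<lambda>e'. e + e') ` keys p \<subseteq> keys (single e 1 * p)"
      using * by (auto simp: in_keys_iff)
  qed
qed

lemma subspace_mon_ideal:
  "up_closed U \<Longrightarrow> ideal.subspace (mon_ideal U :: ('v, 'k::comm_ring_1) mpolynomial set)"
proof (rule ideal.subspaceI)
  fix c x :: "('v, 'k::comm_ring_1) mpolynomial"
  assume "up_closed U" and "x \<in> mon_ideal U"
  then show "c * x \<in> mon_ideal U"
    using keys_mult[of c x] unfolding mon_ideal_def up_closed_def
    by (fastforce simp: add.commute)
next
  fix x y :: "('v, 'k::comm_ring_1) mpolynomial"
  assume "x \<in> mon_ideal U" and "y \<in> mon_ideal U"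
  then show "x + y \<in> mon_ideal U"
    using keys_add[of x y] by (auto simp: mon_ideal_def)
qed (simp add: mon_ideal_def)

lemma poly_mapping_sum_single:
  "p = (\<Sum>e\<in>keys p. single e (lookup p e))"
  by (rule poly_mapping_eqI)
    (simp add: lookup_sum lookup_single when_def in_keys_iff)

lemma mon_ideal_subset_ideal:
  fixes J :: "('v, 'k::comm_ring_1) mpolynomial set"
  assumes "ideal.subspace J" and "\<And>e. e \<in> U \<Longrightarrow> single e 1 \<in> J"
  shows "mon_ideal U \<subseteq> J"
proof
  fix p :: "('v, 'k::comm_ring_1) mpolynomial"
  assume "p \<in> mon_ideal U"
  moreover have "single e c \<in> J" if "e \<in> U" for e c
  proof -
    have "single 0 c * single e 1 \<in> J"
      using assms that by (intro ideal_mult_left)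
    then show ?thesis by (simp add: mult_single)
  qed
  ultimately have "(\<Sum>e\<in>keys p. single e (lookup p e)) \<in> J"
    using assms(1) by (intro ideal.subspace_sum) (auto simp: mon_ideal_def)
  then show "p \<in> J"
    using poly_mapping_sum_single[of p] by simp
qed

lemma ideal_gen_insert_mon:
  assumes "up_closed U"
  shows "ideal_gen (insert (single m 1) (mon_ideal U)) = mon_ideal (U \<union> range (\<lambda>e. m + e))"
    (is "?L = ?R")
proof
  have "up_closed (U \<union> range (\<lambda>e. m + e))"
    using assms by (auto simp: up_closed_def add.assoc)
  then show "?L \<subseteq> ?R"
    by (intro ideal.span_minimal subspace_mon_ideal) (auto simp: mon_ideal_def intro: range_eqI[of _ _ 0])
  show "?R \<subseteq> ?L"
  proof (rule mon_ideal_subset_ideal)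
    fix e assume "e \<in> U \<union> range (\<lambda>e. m + e)"
    then consider "e \<in> U" | e' where "e = m + e'" by auto
    then show "single e 1 \<in> ?L"
    proof cases
      case 1
      then show ?thesis by (intro ideal.span_base) (simp add: mon_ideal_def)
    next
      case 2
      have "single e' 1 * single m 1 \<in> ?L"
        by (intro ideal.span_scale ideal.span_base) simp
      with 2 show ?thesis by (simp add: mult_single add.commute)
    qed
  qed simp
qed

lemma mon_ideal_colon:
  "single m 1 * g \<in> mon_ideal U \<longleftrightarrow> g \<in> mon_ideal {e. m + e \<in> U}"
  by (auto simp: mon_ideal_def keys_single_mult)

lemma weakly_regular_mon_colon:
  assumes "up_closed U" and "weakly_regular (mon_ideal {e. m + e \<in> U}) fs"
    and "weakly_regular (mon_ideal (U \<union> range (\<lambda>e. m + e))) fs"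
  shows "weakly_regular (mon_ideal U) fs"
proof (rule weakly_regular_colon)
  show "ideal.subspace (mon_ideal U)"
    using assms(1) by (rule subspace_mon_ideal)
  have "up_closed {e. m + e \<in> U}"
    using assms(1) unfolding up_closed_def by (auto simp flip: add.assoc)
  then show "ideal.subspace (mon_ideal {e. m + e \<in> U})"
    by (rule subspace_mon_ideal)
  show "weakly_regular (ideal_gen (insert (single m 1) (mon_ideal U))) fs"
    using assms(3) by (simp only: ideal_gen_insert_mon[OF assms(1)])
qed (use assms(2) in \<open>simp_all only: mon_ideal_colon\<close>)

section \<open>Homogeneous ideals and lifting along a linear form\<close>

definition trunc_closed :: "('v, 'k::comm_ring_1) mpolynomial set \<Rightarrow> bool" where
  "trunc_closed J \<longleftrightarrow> (\<forall>p \<in> J. \<forall>n. restrict_keys {e. mon_deg e < n} p \<in> J)"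

lemma trunc_closed_mon_ideal: "trunc_closed (mon_ideal U)"
  by (auto simp: trunc_closed_def mon_ideal_def keys_restrict_keys)

lemma mon_deg_keys_mult:
  "homogeneous n f \<Longrightarrow> e \<in> keys (f * h) \<Longrightarrow> \<exists>e' \<in> keys h. mon_deg e = n + mon_deg e'"
  using keys_mult[of f h] by (force simp: homogeneous_def mon_deg_add)

text \<open>For an ideal, \<open>trunc_closed\<close> means homogeneous, since a homogeneous
  component is a difference of two truncations. Cutting \<open>f * h\<close> below degree
  \<open>n\<close> amounts to cutting \<open>h\<close> below \<open>n - k\<close>, so both summands
  of \<open>p = (p - f * h) + f * h\<close> can be truncated.\<close>

lemma trunc_closed_insert:
  assumes "ideal.subspace J" and "trunc_closed J" and "homogeneous k f"
  shows "trunc_closed (ideal_gen (insert f J))"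
  unfolding trunc_closed_def
proof (intro ballI allI)
  fix p n
  let ?T = "\<lambda>n. restrict_keys {e. mon_deg e < n}"
  assume "p \<in> ideal_gen (insert f J)"
  then obtain h where h: "p - f * h \<in> J"
    using mem_ideal_gen_insert[OF assms(1)] by blast
  \<comment> \<open>For \<open>n < k\<close> the truncated difference is 0 and \<open>?U\<close> is
    empty, in accordance with \<open>f * h\<close> having no term below degree
    \<open>n\<close>.\<close>
  let ?U = "{e. mon_deg e < n - k}"
  have "?T n (f * h) = ?T n (f * restrict_keys ?U h + f * restrict_keys (- ?U) h)"
    by (simp add: restrict_keys_compl flip: distrib_left)
  moreover have "?T n (f * restrict_keys ?U h) = f * restrict_keys ?U h"
    by (rule restrict_keys_id)
      (auto dest!: mon_deg_keys_mult[OF assms(3)] simp: keys_restrict_keys)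
  moreover have "?T n (f * restrict_keys (- ?U) h) = 0"
    by (rule restrict_keys_0)
      (auto dest!: mon_deg_keys_mult[OF assms(3)] simp: keys_restrict_keys)
  ultimately have "?T n (f * h) = f * restrict_keys ?U h"
    by (simp add: restrict_keys_add)
  then have "?T n p - f * restrict_keys ?U h = ?T n (p - f * h)"
    using restrict_keys_add[of "{e. mon_deg e < n}" "p - f * h" "f * h"] by simp
  also have "\<dots> \<in> J"
    using assms(2) h by (simp add: trunc_closed_def)
  finally show "?T n p \<in> ideal_gen (insert f J)"
    using mem_ideal_gen_insert[OF assms(1)] by blast
qed

text \<open>
  If \<open>f g \<in> J\<close>, then regularity of \<open>f\<close> modulo \<open>J + (y)\<close> and of \<open>y\<close> modulo \<open>J\<close> gives
  \<open>g \<in> J + (y\<^sup>n)\<close> for all \<open>n\<close>; truncation in a degree below \<open>n\<close> then gives \<open>g \<in> J\<close>.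
\<close>

lemma nzd_mod_lift:
  assumes J: "ideal.subspace J" and "trunc_closed J" and y: "homogeneous 1 y"
    and ny: "nzd_mod J y" and nf: "nzd_mod (ideal_gen (insert y J)) f"
  shows "nzd_mod J f"
proof (rule nzd_modI)
  fix g assume fg: "f * g \<in> J"
  have "\<exists>h. g - y ^ n * h \<in> J" if "f * g \<in> J" for n g
    using that
  proof (induction n arbitrary: g)
    case 0
    have "g - y ^ 0 * g \<in> J"
      using ideal.subspace_0[OF J] by simp
    then show ?case by blast
  next
    case (Suc n)
    have "f * g \<in> ideal_gen (insert y J)"
      using Suc.prems by (simp add: ideal.span_base)
    then have "g \<in> ideal_gen (insert y J)"
      by (rule nzd_modD[OF nf])
    then obtain h where h: "g - y * h \<in> J"
      using mem_ideal_gen_insert[OF J] by blast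
    have "f * g - f * (g - y * h) \<in> J"
      by (rule ideal.subspace_diff[OF J Suc.prems ideal_mult_left[OF J h]])
    also have "f * g - f * (g - y * h) = y * (f * h)"
      by (simp add: algebra_simps)
    finally have "f * h \<in> J"
      by (rule nzd_modD[OF ny])
    then obtain h' where h': "h - y ^ n * h' \<in> J"
      using Suc.IH by blast
    have "(g - y * h) + y * (h - y ^ n * h') \<in> J"
      by (rule ideal.subspace_add[OF J h ideal_mult_left[OF J h']])
    also have "(g - y * h) + y * (h - y ^ n * h') = g - y ^ Suc n * h'"
      by (simp add: algebra_simps)
    finally show ?case by blast
  qed
  note power = this
  \<comment> \<open>\<open>n\<close> exceeds every degree occurring in \<open>g\<close>; inserting 0
    covers \<open>g = 0\<close>.\<close>
  define n where "n = Suc (Max (insert 0 (mon_deg ` keys g)))"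
  let ?T = "restrict_keys {e. mon_deg e < n}"
  obtain h where h: "g - y ^ n * h \<in> J"
    using power[OF fg] by blast
  have "\<forall>e \<in> keys (y ^ m * h). m \<le> mon_deg e" for m
  proof (induction m)
    case (Suc m)
    then show ?case
      using mon_deg_keys_mult[OF y, of _ "y ^ m * h"] by (fastforce simp: mult.assoc)
  qed simp
  then have "?T (y ^ n * h) = 0"
    by (intro restrict_keys_0) fastforce
  moreover have "?T g = g"
    by (intro restrict_keys_id) (auto simp: n_def less_Suc_eq_le)
  ultimately have "?T (g - y ^ n * h) = g"
    using restrict_keys_add[of "{e. mon_deg e < n}" "g - y ^ n * h" "y ^ n * h"] by simp
  then show "g \<in> J"
    using \<open>trunc_closed J\<close> h unfolding trunc_closed_def by metis
qed

text \<open>In the induction \<open>J\<close> becomes \<open>J + (f)\<close>: it stays homogeneous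
  because \<open>f\<close> is, and \<open>y\<close> stays regular by
  \<open>nzd_mod_weakly_regular\<close>.\<close>

lemma weakly_regular_lift:
  assumes "ideal.subspace J" and "trunc_closed J" and "homogeneous 1 y" and "nzd_mod J y"
    and "\<forall>f \<in> set fs. \<exists>k. homogeneous k f"
    and "weakly_regular (ideal_gen (insert y J)) fs"
  shows "weakly_regular J fs"
  using assms
proof (induction fs arbitrary: J)
  case (Cons f fs)
  let ?J = "ideal_gen (insert f J)"
  have nf: "nzd_mod (ideal_gen (insert y J)) f"
    and fs: "weakly_regular (ideal_gen (insert y ?J)) fs"
    using Cons.prems(6) by (simp_all add: ideal_gen_insert_span insert_commute)
  obtain k where k: "homogeneous k f"
    using Cons.prems(5) by auto
  have "nzd_mod (ideal_gen (J \<union> set [f])) y"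
    by (rule nzd_mod_weakly_regular[OF Cons.prems(1,4)]) (use nf in simp)
  then have "nzd_mod ?J y" by simp
  then have "weakly_regular ?J fs"
    using Cons.IH[OF ideal.subspace_span trunc_closed_insert[OF Cons.prems(1,2) k] Cons.prems(3)]
      Cons.prems(5) fs by auto
  then show ?case
    using nzd_mod_lift[OF Cons.prems(1-4) nf] by (simp only: weakly_regular.simps)
qed simp

section \<open>Elementary symmetric polynomials\<close>

lemma mem_range_add_iff:
  "e \<in> range (\<lambda>e'. m + e') \<longleftrightarrow> (\<forall>v. lookup m v \<le> lookup e v)" for m e :: "'v \<Rightarrow>\<^sub>0 nat"
proof
  assume "\<forall>v. lookup m v \<le> lookup e v"
  then have "e = m + (e - m)"
    by (intro poly_mapping_eqI) (simp add: lookup_add lookup_minus)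
  then show "e \<in> range (\<lambda>e'. m + e')" by blast
qed (auto simp: lookup_add)

definition var_exps :: "'v set \<Rightarrow> ('v \<Rightarrow>\<^sub>0 nat) set" where
  "var_exps W = {e. \<exists>w \<in> W. lookup e w \<noteq> 0}"

lemma up_closed_var_exps: "up_closed (var_exps W)"
  by (auto simp: up_closed_def var_exps_def lookup_add)

lemma var_exps_insert: "var_exps (W :: 'v set) \<union> range (\<lambda>e. single v 1 + e) = var_exps (insert v W)"
proof -
  have "e \<in> range (\<lambda>e. single v 1 + e) \<longleftrightarrow> lookup e v \<noteq> 0" for e :: "'v \<Rightarrow>\<^sub>0 nat"
    unfolding mem_range_add_iff by (auto simp: lookup_single when_def)
  then show ?thesis
    unfolding var_exps_def by (intro set_eqI) (simp only: Un_iff mem_Collect_eq insert_iff, blast)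
qed

lemma homogeneous_elem_sym:
  assumes "finite (UNIV :: 'v set)"
  shows "homogeneous j (elem_sym j :: ('v, 'k::comm_ring_1) mpolynomial)"
proof -
  have "keys (elem_sym j :: ('v, 'k) mpolynomial) \<subseteq> indicator_mon ` {A. card A = j}"
    unfolding elem_sym_def by (rule order_trans[OF keys_sum]) auto
  then show ?thesis
    using mon_deg_indicator_mon[OF assms] by (auto simp: homogeneous_def)
qed

text \<open>Modulo the variables in \<open>W\<close> only squarefree monomials in the remaining
  variables survive, and just one of them has degree \<open>card (- W)\<close>: any other set of
  that size meets \<open>W\<close>.\<close>

lemma elem_sym_card_compl:
  fixes W :: "'v set"
  assumes "finite (UNIV :: 'v set)"
  shows "elem_sym (card (- W)) - single (indicator_mon (- W)) (1 :: 'k::comm_ring_1) \<in> mon_ideal (var_exps W)"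
proof -
  let ?\<A> = "{A. card A = card (- W)} - {- W}"
  note fin = finite_subset[OF subset_UNIV assms]
  have "finite {A :: 'v set. card A = card (- W)}"
    using assms by (auto intro: finite_subset[OF subset_UNIV] simp: Finite_Set.finite_set)
  then have "elem_sym (card (- W)) - single (indicator_mon (- W)) (1 :: 'k)
      = (\<Sum>A\<in>?\<A>. single (indicator_mon A) 1)"
    unfolding elem_sym_def by (subst sum.remove[of _ "- W"]) auto
  moreover have "indicator_mon A \<in> var_exps W" if "A \<in> ?\<A>" for A
  proof -
    have "\<not> A \<subseteq> - W"
      using that card_subset_eq[OF fin] by auto
    then show ?thesis
      by (auto simp: var_exps_def lookup_indicator_mon[OF fin])
  qed
  ultimately show ?thesis
    using keys_sum[of "\<lambda>A. single (indicator_mon A) (1 :: 'k)" ?\<A>]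
    by (fastforce simp: mon_ideal_def)
qed

lemma nzd_mod_indicator_mon:
  assumes "finite A" and "\<And>v. v \<in> A \<Longrightarrow> nzd_mod J (var v)"
  shows "nzd_mod J (single (indicator_mon A) 1)"
  using assms
proof (induction A rule: finite_induct)
  case empty
  show ?case
    by (rule nzd_modI) (simp add: indicator_mon_def)
next
  case (insert v A)
  then have *: "single (indicator_mon (insert v A)) 1 = var v * single (indicator_mon A) 1"
    by (simp add: indicator_mon_def var_def mult_single)
  have IH: "nzd_mod J (single (indicator_mon A) 1)"
    by (rule insert.IH) (simp add: insert.prems)
  show ?case
  proof (rule nzd_modI)
    fix g assume "single (indicator_mon (insert v A)) 1 * g \<in> J"
    then have "var v * (single (indicator_mon A) 1 * g) \<in> J"
      by (simp only: * mult.assoc)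
    then have "single (indicator_mon A) 1 * g \<in> J"
      by (rule nzd_modD[OF insert.prems[OF insertI1]])
    then show "g \<in> J"
      by (rule nzd_modD[OF IH])
  qed
qed

lemma nzd_mod_cong:
  assumes "ideal.subspace J" and "f - f' \<in> J" and "nzd_mod J f'"
  shows "nzd_mod J f"
proof (rule nzd_modI)
  fix g assume "f * g \<in> J"
  then have "f * g - (f - f') * g \<in> J"
    by (rule ideal.subspace_diff[OF assms(1) _ ideal_mult_right[OF assms(1,2)]])
  also have "f * g - (f - f') * g = f' * g"
    by (simp add: algebra_simps)
  finally show "g \<in> J"
    by (rule nzd_modD[OF assms(3)])
qed

lemma nzd_mod_var:
  assumes "v \<notin> W"
  shows "nzd_mod (mon_ideal (var_exps W)) (var v)"
proof (rule nzd_modI)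
  fix g assume "var v * g \<in> mon_ideal (var_exps W)"
  then have "g \<in> mon_ideal {e. single v 1 + e \<in> var_exps W}"
    by (simp only: var_def mon_ideal_colon)
  also have "{e. single v 1 + e \<in> var_exps W} = var_exps W"
    using assms by (auto simp: var_exps_def lookup_add lookup_single when_def)
  finally show "g \<in> mon_ideal (var_exps W)" .
qed

text \<open>
  The elementary symmetric polynomials in all variables are used because they restrict to the
  elementary symmetric polynomials on every quotient by a set of variables, so one sequence serves
  all these quotients simultaneously.
\<close>

lemma weakly_regular_elem_sym_card:
  assumes fin: "finite (UNIV :: 'v set)"
  shows "card (- W) = s \<Longrightarrow>
    weakly_regular (mon_ideal (var_exps W) :: ('v, 'k::comm_ring_1) mpolynomial set) (map elem_sym [1..<Suc s])"
proof (induction s arbitrary: W)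
  case (Suc s)
  let ?J = "mon_ideal (var_exps W) :: ('v, 'k) mpolynomial set"
  let ?fs = "map elem_sym [1..<Suc s] :: ('v, 'k) mpolynomial list"
  note J = subspace_mon_ideal[OF up_closed_var_exps]
  \<comment> \<open>Killing one more variable leaves \<open>s\<close> of them. This is used for one
    fixed \<open>v\<close>, to lift \<open>?fs\<close> to \<open>?J\<close>, and then for every
    \<open>v \<notin> W\<close>, to treat the last polynomial.\<close>
  have fs: "weakly_regular (ideal_gen (insert (var v) ?J)) ?fs" if "v \<notin> W" for v
  proof -
    have "card (- insert v W) = s"
      using Suc.prems that by (simp add: Compl_insert card_Diff_singleton_if)
    then have "weakly_regular (mon_ideal (var_exps (insert v W))) ?fs"
      by (rule Suc.IH)
    then show ?thesis
      by (simp only: var_def ideal_gen_insert_mon[OF up_closed_var_exps] var_exps_insert)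
  qed
  obtain v where v: "v \<notin> W"
    using Suc.prems by (cases "W = UNIV") auto
  have "homogeneous 1 (var v :: ('v, 'k) mpolynomial)"
    using mon_deg_single[OF fin] by (simp add: homogeneous_def var_def)
  then have "weakly_regular ?J ?fs"
    by (rule weakly_regular_lift[OF J trunc_closed_mon_ideal _ nzd_mod_var[OF v] _ fs[OF v]])
      (use homogeneous_elem_sym[OF fin] in auto)
  \<comment> \<open>Modulo \<open>?J\<close> the last polynomial is the product of the variables
    outside \<open>W\<close>, and each of these is regular modulo \<open>?J\<close> and
    \<open>?fs\<close> by the exchange lemma.\<close>
  moreover have "nzd_mod (ideal_gen (?J \<union> set ?fs)) (elem_sym (Suc s))"
  proof (rule nzd_mod_cong)
    show "elem_sym (Suc s) - single (indicator_mon (- W)) 1 \<in> ideal_gen (?J \<union> set ?fs)"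
      using elem_sym_card_compl[OF fin, of W] Suc.prems by (auto intro: ideal.span_base)
    have "nzd_mod (ideal_gen (?J \<union> set ?fs)) (var v)" if "v \<in> - W" for v
      using that nzd_mod_weakly_regular[OF J nzd_mod_var fs] by simp
    then show "nzd_mod (ideal_gen (?J \<union> set ?fs)) (single (indicator_mon (- W)) 1)"
      by (rule nzd_mod_indicator_mon[OF finite_subset[OF subset_UNIV fin]])
  qed simp
  ultimately have "weakly_regular ?J (?fs @ [elem_sym (Suc s)])"
    by (simp only: weakly_regular_snoc[OF J])
  also have "?fs @ [elem_sym (Suc s)] = map elem_sym [1..<Suc (Suc s)]"
    by simp
  finally show ?case .
qed simp

lemma weakly_regular_elem_sym:
  assumes fin: "finite (UNIV :: 'v set)" and "r \<le> card (- W)"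
  shows "weakly_regular (mon_ideal (var_exps W) :: ('v, 'k::comm_ring_1) mpolynomial set) (map elem_sym [1..<Suc r])"
proof (rule weakly_regular_append)
  have "[1..<Suc (card (- W))] = [1..<Suc r] @ [Suc r..<Suc (card (- W))]"
    using upt_add_eq_append[of 1 "Suc r" "card (- W) - r"] assms(2) by simp
  then show "weakly_regular (mon_ideal (var_exps W) :: ('v, 'k) mpolynomial set)
      (map elem_sym [1..<Suc r] @ map elem_sym [Suc r..<Suc (card (- W))])"
    using weakly_regular_elem_sym_card[OF fin refl, of W] by (metis map_append)
qed

section \<open>Edge ideals and packings\<close>

definition elem_syms :: "nat \<Rightarrow> ('v, 'k::comm_ring_1) mpolynomial list" where
  "elem_syms r = map elem_sym [1..<Suc r]"

text \<open>\<open>pair_le u v e\<close> means that \<open>x\<^sub>u x\<^sub>v\<close>, possibly with \<open>u = v\<close>, divides \<open>x\<^sup>e\<close>.\<close>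

definition pair_le :: "'v \<Rightarrow> 'v \<Rightarrow> ('v \<Rightarrow>\<^sub>0 nat) \<Rightarrow> bool" where
  "pair_le u v e \<longleftrightarrow> (if u = v then 2 \<le> lookup e u else lookup e u \<noteq> 0 \<and> lookup e v \<noteq> 0)"

definition edge_exps :: "'v rel \<Rightarrow> ('v \<Rightarrow>\<^sub>0 nat) set" where
  "edge_exps E = {e. \<exists>(u, v) \<in> E. pair_le u v e}"

definition graph_exps :: "'v rel \<Rightarrow> 'v set \<Rightarrow> ('v \<Rightarrow>\<^sub>0 nat) set" where
  "graph_exps E W = edge_exps E \<union> var_exps W"

text \<open>For symmetric \<open>E\<close> this says that the closed neighbourhoods of the elements
  of \<open>T\<close> are pairwise disjoint, that is, distances within \<open>T\<close> are at least
  3.\<close>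

definition packing :: "'v rel \<Rightarrow> 'v set \<Rightarrow> bool" where
  "packing E T \<longleftrightarrow> (\<forall>t \<in> T. \<forall>t' \<in> T. t \<noteq> t' \<longrightarrow> (t, t') \<notin> E \<and> (\<forall>c. (t, c) \<in> E \<longrightarrow> (t', c) \<notin> E))"

lemma pair_le_iff: "pair_le u v e \<longleftrightarrow> (\<forall>w. lookup (single u 1 + single v 1) w \<le> lookup e w)"
proof
  assume "\<forall>w. lookup (single u 1 + single v 1) w \<le> lookup e w"
  from this[THEN spec, of u] this[THEN spec, of v] show "pair_le u v e"
    by (auto simp: pair_le_def lookup_add lookup_single when_def split: if_splits)
qed (auto simp: pair_le_def lookup_add lookup_single when_def)

lemma pair_le_add: "pair_le u v e \<Longrightarrow> pair_le u v (e + e')"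
  by (auto simp: pair_le_def lookup_add)

lemma up_closed_graph_exps: "up_closed (graph_exps E W)"
  using up_closed_var_exps[of W]
  by (auto simp: up_closed_def graph_exps_def edge_exps_def intro: pair_le_add)

lemma graph_exps_insert:
  "graph_exps E W \<union> range (\<lambda>e. single a 1 + e) = graph_exps E (insert a W)"
  by (simp only: graph_exps_def Un_assoc var_exps_insert)

text \<open>An edge at \<open>a\<close> leaves its other end as a variable. A loop at
  \<open>a\<close> stands for the square of a variable and leaves that variable, \<open>a\<close>
  being its own neighbour then.\<close>

lemma graph_exps_colon:
  assumes "sym E" and "a \<notin> W"
  shows "{e. single a 1 + e \<in> graph_exps E W} = graph_exps E (W \<union> E `` {a})"
proof (intro set_eqI iffI)
  fix e
  assume "e \<in> {e. single a 1 + e \<in> graph_exps E W}"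
  then consider (edge) u v where "(u, v) \<in> E" "pair_le u v (single a 1 + e)"
    | (var) w where "w \<in> W" "lookup (single a 1 + e) w \<noteq> 0"
    by (auto simp: graph_exps_def edge_exps_def var_exps_def)
  then show "e \<in> graph_exps E (W \<union> E `` {a})"
  proof cases
    case edge
    have "pair_le u v e \<or> u = a \<and> lookup e v \<noteq> 0 \<or> v = a \<and> lookup e u \<noteq> 0"
      using edge(2) by (auto simp: pair_le_def lookup_add lookup_single when_def split: if_splits)
    with edge(1) symD[OF assms(1) edge(1)] show ?thesis
      by (auto simp: graph_exps_def edge_exps_def var_exps_def)
  next
    case var
    then show ?thesis
      using assms(2) by (auto simp: graph_exps_def var_exps_def lookup_add lookup_single when_def split: if_splits)
  qed
next
  fix e
  assume "e \<in> graph_exps E (W \<union> E `` {a})"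
  then consider "e \<in> graph_exps E W" | w where "(a, w) \<in> E" "lookup e w \<noteq> 0"
    by (auto simp: graph_exps_def var_exps_def)
  then show "e \<in> {e. single a 1 + e \<in> graph_exps E W}"
  proof cases
    case 1
    then have "e + single a 1 \<in> graph_exps E W"
      using up_closed_graph_exps by (auto simp: up_closed_def)
    then show ?thesis by (simp add: add.commute)
  next
    case 2
    then have "pair_le a w (single a 1 + e)"
      by (auto simp: pair_le_def lookup_add lookup_single when_def)
    with 2 show ?thesis by (auto simp: graph_exps_def edge_exps_def)
  qed
qed

lemma weakly_regular_graph_exps_split:
  assumes "sym E" and "a \<notin> W"
    and "weakly_regular (mon_ideal (graph_exps E (W \<union> E `` {a}))) fs"
    and "weakly_regular (mon_ideal (graph_exps E (insert a W))) fs"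
  shows "weakly_regular (mon_ideal (graph_exps E W)) fs"
  by (rule weakly_regular_mon_colon[where m = "single a 1", OF up_closed_graph_exps])
    (use assms(3,4) in \<open>simp_all only: graph_exps_colon[OF assms(1,2)] graph_exps_insert\<close>)

text \<open>
  Splitting at a vertex \<open>a\<close> of an edge: modulo \<open>x\<^sub>a\<close> nothing changes for \<open>T\<close>, while in the colon
  ideal by \<open>x\<^sub>a\<close> the variable \<open>x\<^sub>a\<close> is free and may replace the only element of \<open>T\<close> adjacent to it.
\<close>

lemma weakly_regular_packing:
  fixes E :: "'v rel"
  assumes fin: "finite (UNIV :: 'v set)" and sym: "sym E" and "\<And>a. (a, a) \<in> E \<Longrightarrow> a \<in> W"
    and "T \<inter> W = {}" and "r \<le> card T"
    and "\<And>t t'. t \<in> T \<Longrightarrow> t' \<in> T \<Longrightarrow> t \<noteq> t' \<Longrightarrow> (t, t') \<notin> E"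
    and "\<And>t t' c. t \<in> T \<Longrightarrow> t' \<in> T \<Longrightarrow> t \<noteq> t' \<Longrightarrow> c \<notin> W \<Longrightarrow> (t, c) \<in> E \<Longrightarrow> (t', c) \<notin> E"
  shows "weakly_regular (mon_ideal (graph_exps E W)) (elem_syms r :: ('v, 'k::comm_ring_1) mpolynomial list)"
  using assms(3-)
proof (induction "card (- W)" arbitrary: W T rule: less_induct)
  case less
  note finA = finite_subset[OF subset_UNIV fin]
  show ?case
  proof (cases "\<exists>a b. (a, b) \<in> E \<and> a \<notin> W \<and> b \<notin> W")
    case False
    \<comment> \<open>Every edge, loops included, has an end in \<open>W\<close>, so the ideal is
      generated by variables.\<close>
    then have "graph_exps E W = var_exps W"
      by (auto simp: graph_exps_def edge_exps_def var_exps_def pair_le_def split: if_splits)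
        (metis not_numeral_le_zero)+
    moreover have "r \<le> card (- W)"
      using card_mono[OF finA, of T "- W"] disjoint_eq_subset_Compl[of T W] less.prems(2,3) by simp
    ultimately show ?thesis
      using weakly_regular_elem_sym[OF fin, of r W] by (simp add: elem_syms_def)
  next
    case True
    \<comment> \<open>\<open>T\<close> contains no edge, so one end of the edge lies outside
      \<open>T\<close>; by symmetry it may be called \<open>a\<close>.\<close>
    then obtain a b where ab: "(a, b) \<in> E" "a \<notin> W" "b \<notin> W" "a \<notin> T"
      using less.prems(1,4) symD[OF sym] by metis
    let ?A = "insert a W" and ?C = "W \<union> E `` {a}"
    have "card (- ?A) < card (- W)" "card (- ?C) < card (- W)"
      using ab by (auto intro!: psubset_card_mono finA)
    note IH = this[THEN less.hyps]
    have "weakly_regular (mon_ideal (graph_exps E ?A)) (elem_syms r :: ('v, 'k) mpolynomial list)"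
    proof (rule IH(1)[where T = T])
      show "(t', c) \<notin> E" if "t \<in> T" "t' \<in> T" "t \<noteq> t'" "c \<notin> ?A" "(t, c) \<in> E" for t t' c
        using less.prems(5)[of t t' c] that by simp
    qed (use less.prems(1-4) ab(4) in simp_all)
    moreover have "weakly_regular (mon_ideal (graph_exps E ?C)) (elem_syms r :: ('v, 'k) mpolynomial list)"
    proof (cases "\<exists>t \<in> T. (t, a) \<in> E")
      case False
      show ?thesis
      proof (rule IH(2)[where T = T])
        show "T \<inter> ?C = {}"
          using less.prems(2) False symD[OF sym] by blast
        show "(t', c) \<notin> E" if "t \<in> T" "t' \<in> T" "t \<noteq> t'" "c \<notin> ?C" "(t, c) \<in> E" for t t' c
          using less.prems(5)[of t t' c] that by simp
      qed (use less.prems(1,3,4) in simp_all)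
    next
      case True
      then obtain t where t: "t \<in> T" "(t, a) \<in> E" by blast
      let ?T = "insert a (T - {t})"
      \<comment> \<open>Otherwise \<open>a \<notin> W\<close> would be a common neighbour of
        \<open>t\<close> and \<open>t'\<close>. So \<open>a\<close> is nonadjacent to the rest of
        \<open>T\<close>, and as all its neighbours lie in \<open>?C\<close>, it shares none outside
        \<open>?C\<close>.\<close>
      have na: "(t', a) \<notin> E" "(a, t') \<notin> E" if "t' \<in> T" "t' \<noteq> t" for t'
        using that t less.prems(5)[of t t' a] ab(2) symD[OF sym] by blast+
      have "card ?T = card T"
        using ab(4) t(1) finA[of T] card_Suc_Diff1[of T t] by simp
      show ?thesis
      proof (rule IH(2)[where T = ?T])
        show "r \<le> card ?T"
          using less.prems(3) \<open>card ?T = card T\<close> by simp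
        have "a \<notin> ?C"
          using less.prems(1) ab(2) by blast
        then show "?T \<inter> ?C = {}"
          using less.prems(2) na by blast
        show "(s, s') \<notin> E" if "s \<in> ?T" "s' \<in> ?T" "s \<noteq> s'" for s s'
          using that na less.prems(4)[of s s'] by blast
        show "(s', c) \<notin> E" if "s \<in> ?T" "s' \<in> ?T" "s \<noteq> s'" "c \<notin> ?C" "(s, c) \<in> E" for s s' c
          using that less.prems(5)[of s s' c] by blast
      qed (use less.prems(1) in simp)
    qed
    ultimately show ?thesis
      by (rule weakly_regular_graph_exps_split[OF sym ab(2), rotated])
  qed
qed

section \<open>Colon ideals of the squared edge ideal by an edge\<close>

definition colon_rel :: "'v rel \<Rightarrow> 'v \<Rightarrow> 'v \<Rightarrow> 'v rel" where
  "colon_rel E x y = E \<union> E `` {x} \<times> E `` {y} \<union> E `` {y} \<times> E `` {x}"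

text \<open>
  A common neighbour \<open>a\<close> of \<open>x\<close> and \<open>y\<close> contributes \<open>x\<^sub>a\<^sup>2\<close> to the ideal. Its colon ideal by \<open>x\<^sub>a\<close>
  contains all variables of \<open>N(x) \<union> N(y) \<union> N(a)\<close>, which removes all squares at once.
\<close>

lemma weakly_regular_colon_rel:
  fixes E :: "'v rel"
  assumes fin: "finite (UNIV :: 'v set)" and sym: "sym E" and irrefl: "irrefl E"
    and base: "\<exists>T. packing E T \<and> T \<inter> (E `` {x} \<union> E `` {y}) = {} \<and> r \<le> card T"
    and loop: "\<And>a. a \<in> E `` {x} \<inter> E `` {y} \<Longrightarrow>
      \<exists>T. packing E T \<and> T \<inter> (E `` {x} \<union> E `` {y} \<union> E `` {a}) = {} \<and> r \<le> card T"
    and "W \<subseteq> E `` {x} \<union> E `` {y}"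
  shows "weakly_regular (mon_ideal (graph_exps (colon_rel E x y) W)) (elem_syms r :: ('v, 'k::comm_ring_1) mpolynomial list)"
  using assms(6)
proof (induction "card (- W)" arbitrary: W rule: less_induct)
  case less
  let ?N = "E `` {x} \<union> E `` {y}" and ?E = "colon_rel E x y"
  note finA = finite_subset[OF subset_UNIV fin]
  have symE: "sym ?E"
    using sym unfolding colon_rel_def sym_def by blast
  \<comment> \<open>A loop stands for a square. As \<open>E\<close> has none, loops come from common
    neighbours of \<open>x\<close> and \<open>y\<close>.\<close>
  have loops: "a \<in> E `` {x} \<inter> E `` {y}" if "(a, a) \<in> ?E" for a
    using that irrefl by (auto simp: colon_rel_def irrefl_def)
  \<comment> \<open>New edges join elements of \<open>?N\<close>, so a packing that avoids
    \<open>?N\<close> meets only edges of \<open>E\<close> and remains a packing for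
    \<open>?E\<close>.\<close>
  have packing: "weakly_regular (mon_ideal (graph_exps ?E W')) (elem_syms r :: ('v, 'k) mpolynomial list)"
    if T: "packing E T" "T \<inter> ?N = {}" "T \<inter> W' = {}" "r \<le> card T"
      and "\<And>a. (a, a) \<in> ?E \<Longrightarrow> a \<in> W'" for T W'
  proof (rule weakly_regular_packing[OF fin symE, where T = T])
    have *: "(t, c) \<in> E" if "t \<in> T" "(t, c) \<in> ?E" for t c
      using that T(2) by (auto simp: colon_rel_def)
    show "(t, t') \<notin> ?E" if "t \<in> T" "t' \<in> T" "t \<noteq> t'" for t t'
      using that T(1) * unfolding packing_def by blast
    show "(t', c) \<notin> ?E" if "t \<in> T" "t' \<in> T" "t \<noteq> t'" "(t, c) \<in> ?E" for t t' c
      using that T(1) * unfolding packing_def by blast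
  qed (use that in auto)
  show ?case
  proof (cases "\<exists>a. (a, a) \<in> ?E \<and> a \<notin> W")
    case False
    then show ?thesis
      using base less.prems by (blast intro: packing)
  next
    case True
    then obtain a where a: "(a, a) \<in> ?E" "a \<notin> W" by blast
    note aN = loops[OF a(1)]
    have "?E `` {a} = ?N \<union> E `` {a}"
      using aN by (auto simp: colon_rel_def)
    then have W: "W \<union> ?E `` {a} = ?N \<union> E `` {a}"
      using less.prems by blast
    show ?thesis
    proof (rule weakly_regular_graph_exps_split[OF symE a(2)])
      show "weakly_regular (mon_ideal (graph_exps ?E (insert a W))) (elem_syms r :: ('v, 'k) mpolynomial list)"
        by (rule less.hyps) (use less.prems a(2) aN in \<open>auto intro!: psubset_card_mono finA\<close>)
      obtain T where T: "packing E T" "T \<inter> (?N \<union> E `` {a}) = {}" "r \<le> card T"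
        using loop[OF aN] by blast
      show "weakly_regular (mon_ideal (graph_exps ?E (W \<union> ?E `` {a}))) (elem_syms r :: ('v, 'k) mpolynomial list)"
        unfolding W by (rule packing[OF T(1) _ T(2,3)]) (use T(2) loops in auto)
    qed
  qed
qed

definition square_exps :: "'v rel \<Rightarrow> ('v \<Rightarrow>\<^sub>0 nat) set" where
  "square_exps E = {e. \<exists>(a, b) \<in> E. \<exists>(c, d) \<in> E.
     \<forall>w. lookup (single a 1 + single b 1 + (single c 1 + single d 1)) w \<le> lookup e w}"

lemma up_closed_square_exps: "up_closed (square_exps E \<union> edge_exps F)"
proof -
  have "m w \<le> lookup (e + e') w" if "\<forall>w. m w \<le> lookup e w" for m w and e e' :: "'a \<Rightarrow>\<^sub>0 nat"
    using that by (simp add: lookup_add trans_le_add1)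
  then have "up_closed (square_exps E)"
    unfolding up_closed_def square_exps_def by blast
  moreover have "up_closed (edge_exps F)"
    unfolding up_closed_def edge_exps_def by (blast intro: pair_le_add)
  ultimately show ?thesis
    unfolding up_closed_def by blast
qed

lemma edge_exps_insert:
  "edge_exps F \<union> range (\<lambda>e. single x 1 + single y 1 + e) = edge_exps (insert (x, y) (insert (y, x) F))"
proof -
  have "e \<in> range (\<lambda>e. single x 1 + single y 1 + e) \<longleftrightarrow> pair_le x y e" for e :: "'a \<Rightarrow>\<^sub>0 nat"
    unfolding mem_range_add_iff pair_le_iff ..
  moreover have "pair_le y x e \<longleftrightarrow> pair_le x y e" for e
    by (auto simp: pair_le_def)
  ultimately show ?thesis
    unfolding edge_exps_def by (intro set_eqI) (simp only: Un_iff mem_Collect_eq bex_simps insert_iff, auto)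
qed

text \<open>A vertex of either edge outside \<open>{x, y}\<close> must be supplied by
  \<open>f\<close>, and so must a vertex shared by both edges, since \<open>xy\<close> supplies it
  at most once. Hence \<open>f\<close> supplies one whole edge, unless the edges take
  \<open>x\<close> and \<open>y\<close> separately, which the last two assumptions exclude.\<close>

lemma pairs_covered:
  fixes f :: "'v \<Rightarrow> nat"
  assumes le: "\<And>w. lookup (single a 1) w + lookup (single b 1) w + (lookup (single c 1) w + lookup (single d 1) w)
      \<le> lookup (single x 1) w + lookup (single y 1) w + f w"
    and neq: "a \<noteq> b" "c \<noteq> d" "x \<noteq> y"
    and "x \<notin> {a, b} \<or> y \<notin> {c, d}" and "y \<notin> {a, b} \<or> x \<notin> {c, d}"
  shows "f a \<noteq> 0 \<and> f b \<noteq> 0 \<or> f c \<noteq> 0 \<and> f d \<noteq> 0"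
proof -
  have one: "f v \<noteq> 0" if "v \<in> {a, b, c, d}" "v \<noteq> x" "v \<noteq> y" for v
  proof -
    have "1 \<le> lookup (single a 1) v + lookup (single b 1) v + (lookup (single c 1) v + lookup (single d (1::nat)) v)"
      using that(1) by (auto simp: lookup_single)
    with le[of v] that(2,3) show ?thesis by (simp add: lookup_single)
  qed
  have two: "f v \<noteq> 0" if "v \<in> {a, b}" "v \<in> {c, d}" for v
  proof -
    have "2 \<le> lookup (single a 1) v + lookup (single b 1) v + (lookup (single c 1) v + lookup (single d (1::nat)) v)"
      using that by (auto simp: lookup_single)
    moreover have "lookup (single x 1) v + lookup (single y (1::nat)) v \<le> 1"
      using neq(3) by (auto simp: lookup_single when_def)
    ultimately show ?thesis using le[of v] by simp
  qed
  \<comment> \<open>If each edge meets \<open>{x, y}\<close>, the assumptions force both to meet it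
    in the same single vertex \<open>z\<close>.\<close>
  consider "x \<notin> {a, b}" "y \<notin> {a, b}" | "x \<notin> {c, d}" "y \<notin> {c, d}"
    | z where "z \<in> {x, y}" "z \<in> {a, b}" "z \<in> {c, d}" "{x, y} \<inter> {a, b} \<subseteq> {z}" 
    using assms(5,6) by blast
  then show ?thesis
  proof cases
    case 1
    with one[of a] one[of b] show ?thesis by auto
  next
    case 2
    with one[of c] one[of d] show ?thesis by auto
  next
    case 3
    have "f v \<noteq> 0" if v: "v \<in> {a, b}" for v
    proof (cases "v = z")
      case True
      with 3 two show ?thesis by blast
    next
      case False
      with 3(4) v have "v \<noteq> x" "v \<noteq> y" by blast+
      with one[of v] v show ?thesis by blast
    qed
    then show ?thesis by simp
  qed
qed

text \<open>\<open>F\<close> holds the edges already added. If \<open>x\<close> and \<open>y\<close>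
  are cancelled from different factors of a product of two edges, the opposite ends form a pair in
  \<open>colon_rel\<close>; otherwise \<open>pairs_covered\<close> leaves an edge of
  \<open>E\<close>. An edge of \<open>F\<close> differs from \<open>xy\<close>, so it leaves its
  other end if it meets \<open>{x, y}\<close>, and itself if not.\<close>

lemma square_exps_colon:
  assumes sym: "sym E" and irrefl: "irrefl E" and xy: "(x, y) \<in> E"
    and F: "F \<subseteq> E" "sym F" "(x, y) \<notin> F"
  shows "{e. single x 1 + single y 1 + e \<in> square_exps E \<union> edge_exps F}
    = graph_exps (colon_rel E x y) (F `` {x} \<union> F `` {y})"
    (is "?L = ?R")
proof (intro set_eqI iffI)
  fix e
  let ?m = "single x 1 + single y 1 :: 'a \<Rightarrow>\<^sub>0 nat"
  note lookups = lookup_add lookup_single when_def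
  have neq: "u \<noteq> v" if "(u, v) \<in> E" for u v
    using that irrefl by (auto simp: irrefl_def)
  have edgeI: "e \<in> ?R" if "(u, v) \<in> colon_rel E x y" "pair_le u v e" for u v
    using that by (auto simp: graph_exps_def edge_exps_def)
  have varI: "e \<in> ?R" if "(x, w) \<in> F \<or> (y, w) \<in> F" "lookup e w \<noteq> 0" for w
    using that by (auto simp: graph_exps_def var_exps_def)
  {
    assume "e \<in> ?L"
    then consider (square) a b c d where "(a, b) \<in> E" "(c, d) \<in> E"
        "\<And>w. lookup (single a 1 + single b 1 + (single c 1 + single d 1)) w \<le> lookup (?m + e) w"
      | (edge) u v where "(u, v) \<in> F" "pair_le u v (?m + e)"
      by (auto simp: square_exps_def edge_exps_def)
    then show "e \<in> ?R"
    proof cases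
      case square
      have cross: "e \<in> ?R" if "(x, b) \<in> E" "(y, d) \<in> E"
        "\<And>w. lookup (?m + (single b 1 + single d 1)) w \<le> lookup (?m + e) w" for b d
      proof (rule edgeI)
        show "(b, d) \<in> colon_rel E x y"
          using that(1,2) by (auto simp: colon_rel_def)
        show "pair_le b d e"
          unfolding pair_le_iff using that(3) by (simp add: lookup_add)
      qed
      have inE: "e \<in> ?R" if "(u, v) \<in> E" "lookup e u \<noteq> 0" "lookup e v \<noteq> 0" for u v
        using that neq by (intro edgeI[of u v]) (auto simp: colon_rel_def pair_le_def)
      note ba = symD[OF sym square(1)] and dc = symD[OF sym square(2)]
      have le: "lookup (single a 1) w + lookup (single b 1) w + (lookup (single c 1) w + lookup (single d 1) w)
          \<le> lookup (single x 1) w + lookup (single y 1) w + lookup e w" for w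
        using square(3)[of w] by (simp add: lookup_add)
      \<comment> \<open>One statement for the eight ways to place \<open>x\<close> and
        \<open>y\<close> on ends of different edges; \<open>p'\<close> and \<open>q'\<close> are the
        opposite ends.\<close>
      have crosses: "e \<in> ?R" if "{p, p'} = {a, b} \<and> {q, q'} = {c, d} \<or> {p, p'} = {c, d} \<and> {q, q'} = {a, b}"
        "p = x" "q = y" for p p' q q'
      proof (rule cross)
        show "(x, p') \<in> E" "(y, q') \<in> E"
          using that square(1,2) ba dc by (auto simp: doubleton_eq_iff)
        show "lookup (?m + (single p' 1 + single q' 1)) w \<le> lookup (?m + e) w" for w
          using that le[of w] by (auto simp: doubleton_eq_iff lookup_add)
      qed
      consider "a = x" "c = y" | "a = x" "d = y" | "b = x" "c = y" | "b = x" "d = y"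
        | "c = x" "a = y" | "c = x" "b = y" | "d = x" "a = y" | "d = x" "b = y"
        | "x \<notin> {a, b} \<or> y \<notin> {c, d}" "y \<notin> {a, b} \<or> x \<notin> {c, d}"
        by blast
      then show ?thesis
      proof cases
        case 9
        from pairs_covered[OF le neq[OF square(1)] neq[OF square(2)] neq[OF xy] this]
        have "lookup e a \<noteq> 0 \<and> lookup e b \<noteq> 0 \<or> lookup e c \<noteq> 0 \<and> lookup e d \<noteq> 0" .
        then show ?thesis
          using square(1,2) inE by blast
      next
        case 1
        then show ?thesis by (intro crosses[of a b c d]) auto
      next
        case 2
        then show ?thesis by (intro crosses[of a b d c]) auto
      next
        case 3
        then show ?thesis by (intro crosses[of b a c d]) auto
      next
        case 4
        then show ?thesis by (intro crosses[of b a d c]) auto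
      next
        case 5
        then show ?thesis by (intro crosses[of c d a b]) auto
      next
        case 6
        then show ?thesis by (intro crosses[of c d b a]) auto
      next
        case 7
        then show ?thesis by (intro crosses[of d c a b]) auto
      next
        case 8
        then show ?thesis by (intro crosses[of d c b a]) auto
      qed
    next
      case edge
      have uv: "(u, v) \<in> E" "(v, u) \<in> F" "u \<noteq> v"
        using edge(1) F(1) symD[OF F(2) edge(1)] neq by auto
      have "(u = x \<or> u = y \<or> lookup e u \<noteq> 0) \<and> (v = x \<or> v = y \<or> lookup e v \<noteq> 0)"
        using edge(2) uv(3) by (auto simp: pair_le_def lookups split: if_splits)
      moreover have "\<not> (u \<in> {x, y} \<and> v \<in> {x, y})"
        using edge(1) uv F(3) by auto
      ultimately consider "u \<in> {x, y}" "lookup e v \<noteq> 0" | "v \<in> {x, y}" "lookup e u \<noteq> 0"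
        | "lookup e u \<noteq> 0" "lookup e v \<noteq> 0"
        by blast
      then show ?thesis
      proof cases
        case 1 then show ?thesis using edge(1) by (intro varI[of v]) auto
      next
        case 2 then show ?thesis using uv(2) by (intro varI[of u]) auto
      next
        case 3 then show ?thesis
          using uv by (intro edgeI[of u v]) (auto simp: colon_rel_def pair_le_def)
      qed
    qed
  }
  {
    assume "e \<in> ?R"
    then consider (edge) u v where "(u, v) \<in> colon_rel E x y" "pair_le u v e"
      | (var) w where "(x, w) \<in> F \<or> (y, w) \<in> F" "lookup e w \<noteq> 0"
      by (auto simp: graph_exps_def edge_exps_def var_exps_def)
    then show "e \<in> ?L"
    proof cases
      case edge
      \<comment> \<open>Times \<open>xy\<close>, each generator is a product of two edges:
        \<open>uv\<close> and \<open>xy\<close>, or after regrouping \<open>xu\<close> and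
        \<open>yv\<close>, or \<open>yu\<close> and \<open>xv\<close>.\<close>
      have "\<exists>a b c d. (a, b) \<in> E \<and> (c, d) \<in> E \<and>
        single a 1 + single b 1 + (single c 1 + single d 1) = ?m + (single u 1 + single v 1)"
      proof -
        consider "(u, v) \<in> E" | "(x, u) \<in> E" "(y, v) \<in> E" | "(y, u) \<in> E" "(x, v) \<in> E"
          using edge(1) by (auto simp: colon_rel_def)
        then show ?thesis
        proof cases
          case 1 with xy show ?thesis by blast
        next
          case 2
          then show ?thesis
            by (intro exI[of _ x] exI[of _ u] exI[of _ y] exI[of _ v]) (simp add: ac_simps)
        next
          case 3
          then show ?thesis
            by (intro exI[of _ y] exI[of _ u] exI[of _ x] exI[of _ v]) (simp add: ac_simps)
        qed
      qed
      then obtain a b c d where abcd: "(a, b) \<in> E" "(c, d) \<in> E"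
        "single a 1 + single b 1 + (single c 1 + single d 1) = ?m + (single u 1 + single v 1)"
        by blast
      have "\<forall>w. lookup (single a 1 + single b 1 + (single c 1 + single d 1)) w \<le> lookup (?m + e) w"
        unfolding abcd(3) using edge(2)[unfolded pair_le_iff] by (simp add: lookup_add)
      with abcd(1,2) show ?thesis
        unfolding square_exps_def by blast
    next
      case var
      then have "pair_le x w (?m + e) \<and> (x, w) \<in> F \<or> pair_le y w (?m + e) \<and> (y, w) \<in> F"
        using F(1) neq by (auto simp: pair_le_def lookups)
      then show ?thesis by (auto simp: edge_exps_def)
    qed
  }
qed

text \<open>Induction on the number of edges outside \<open>F\<close>, splitting at the monomial of
  a missing edge. The sum adds the edge to \<open>F\<close>, the colon ideal falls under
  \<open>weakly_regular_colon_rel\<close>, and \<open>F = E\<close> gives the edge ideal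
  itself.\<close>

lemma weakly_regular_square_exps:
  fixes E :: "'v rel"
  assumes fin: "finite (UNIV :: 'v set)" and sym: "sym E" and irrefl: "irrefl E"
    and ex: "\<exists>T. packing E T \<and> r \<le> card T"
    and base: "\<And>x y. (x, y) \<in> E \<Longrightarrow> \<exists>T. packing E T \<and> T \<inter> (E `` {x} \<union> E `` {y}) = {} \<and> r \<le> card T"
    and loop: "\<And>x y a. (x, y) \<in> E \<Longrightarrow> a \<in> E `` {x} \<inter> E `` {y} \<Longrightarrow>
      \<exists>T. packing E T \<and> T \<inter> (E `` {x} \<union> E `` {y} \<union> E `` {a}) = {} \<and> r \<le> card T"
    and "F \<subseteq> E" and "sym F"
  shows "weakly_regular (mon_ideal (square_exps E \<union> edge_exps F)) (elem_syms r :: ('v, 'k::comm_ring_1) mpolynomial list)"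
  using assms(7,8)
proof (induction "card (E - F)" arbitrary: F rule: less_induct)
  case less
  have finE: "finite A" for A :: "'v rel"
    using finite_subset[OF subset_UNIV, of A] fin by (simp add: finite_Prod_UNIV)
  show ?case
  proof (cases "F = E")
    case True
    have "pair_le a b e" if "\<forall>w. lookup (single a 1 + single b 1 + (single c 1 + single d 1)) w \<le> lookup e w"
      for a b c d and e :: "'v \<Rightarrow>\<^sub>0 nat"
      unfolding pair_le_iff
    proof
      fix w
      show "lookup (single a 1 + single b 1) w \<le> lookup e w"
        using that[THEN spec, of w] by (simp only: lookup_add[of "single a 1 + single b 1"])
    qed
    then have "square_exps E \<subseteq> edge_exps E"
      unfolding square_exps_def edge_exps_def by blast
    then have "square_exps E \<union> edge_exps F = graph_exps E {}"
      using True by (auto simp: graph_exps_def var_exps_def)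
    moreover obtain T where T: "packing E T" "r \<le> card T"
      using ex by blast
    have "weakly_regular (mon_ideal (graph_exps E {})) (elem_syms r :: ('v, 'k) mpolynomial list)"
    proof (rule weakly_regular_packing[OF fin sym, where T = T])
      show "a \<in> {}" if "(a, a) \<in> E" for a
        using that irrefl by (simp add: irrefl_def)
      show "(t, t') \<notin> E" if "t \<in> T" "t' \<in> T" "t \<noteq> t'" for t t'
        using that T(1) unfolding packing_def by blast
      show "(t', c) \<notin> E" if "t \<in> T" "t' \<in> T" "t \<noteq> t'" "(t, c) \<in> E" for t t' c
        using that T(1) unfolding packing_def by blast
    qed (use T(2) in simp_all)
    ultimately show ?thesis by simp
  next
    case False
    then obtain x y where xy: "(x, y) \<in> E" "(x, y) \<notin> F"
      using less.prems by auto
    let ?F = "insert (x, y) (insert (y, x) F)"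
    have "?F \<subseteq> E" "sym ?F"
      using less.prems xy symD[OF sym] by (auto simp: sym_def)
    moreover have "card (E - ?F) < card (E - F)"
      using xy by (intro psubset_card_mono finE) auto
    ultimately have sum: "weakly_regular (mon_ideal (square_exps E \<union> edge_exps ?F)) (elem_syms r :: ('v, 'k) mpolynomial list)"
      by (intro less.hyps)
    have "F `` {x} \<union> F `` {y} \<subseteq> E `` {x} \<union> E `` {y}"
      using less.prems(1) by auto
    then have colon: "weakly_regular (mon_ideal (graph_exps (colon_rel E x y) (F `` {x} \<union> F `` {y})))
        (elem_syms r :: ('v, 'k) mpolynomial list)"
      using xy(1) by (intro weakly_regular_colon_rel[OF fin sym irrefl] base loop)
    show ?thesis
      by (rule weakly_regular_mon_colon[where m = "single x 1 + single y 1", OF up_closed_square_exps])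
        (use colon sum in \<open>simp_all only: square_exps_colon[OF sym irrefl xy(1) less.prems xy(2)] Un_assoc edge_exps_insert\<close>)
  qed
qed

section \<open>The square of the edge ideal\<close>

lemma edge_ideal_subset: "edge_ideal G \<subseteq> mon_ideal (edge_exps (parcs G))"
  unfolding edge_ideal_def
proof (rule ideal.span_minimal)
  show "ideal.subspace (mon_ideal (edge_exps (parcs G)))"
    using up_closed_graph_exps[of "parcs G" "{}"]
    by (intro subspace_mon_ideal) (simp add: graph_exps_def var_exps_def)
qed (auto simp: var_def mult_single mon_ideal_def edge_exps_def pair_le_iff intro!: bexI)

lemma up_closed_square_exps': "up_closed (square_exps E)"
  using up_closed_square_exps[of E "{}"] by (simp add: edge_exps_def)

lemma ideal_mult_edge_ideal:
  "ideal_mult (edge_ideal G) (edge_ideal G) = (mon_ideal (square_exps (parcs G)) :: ('v, 'k::comm_ring_1) mpolynomial set)"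
    (is "?L = ?R")
proof
  show "?L \<subseteq> ?R"
    unfolding ideal_mult_def
  proof (rule ideal.span_minimal)
    show "ideal.subspace ?R"
      by (rule subspace_mon_ideal[OF up_closed_square_exps'])
    have "keys (a * b) \<subseteq> square_exps (parcs G)"
      if ab: "a \<in> edge_ideal G" "b \<in> edge_ideal G" for a b :: "('v, 'k) mpolynomial"
    proof
      fix e assume "e \<in> keys (a * b)"
      then obtain e1 e2 where e: "e = e1 + e2" "e1 \<in> keys a" "e2 \<in> keys b"
        using keys_mult[of a b] by blast
      then have "e1 \<in> edge_exps (parcs G)" "e2 \<in> edge_exps (parcs G)"
        using ab edge_ideal_subset by (auto simp: mon_ideal_def)
      then obtain u v c d where *: "(u, v) \<in> parcs G" "pair_le u v e1" "(c, d) \<in> parcs G" "pair_le c d e2"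
        by (auto simp: edge_exps_def)
      then have "lookup (single u 1 + single v 1 + (single c 1 + single d 1)) w \<le> lookup e w" for w
        unfolding pair_le_iff e(1) by (simp only: lookup_add[of "single u 1 + single v 1"] lookup_add[of e1] add_mono)
      with * show "e \<in> square_exps (parcs G)"
        unfolding square_exps_def by blast
    qed
    then show "{a * b |a b. a \<in> edge_ideal G \<and> b \<in> edge_ideal G} \<subseteq> ?R"
      by (auto simp: mon_ideal_def)
  qed
  show "?R \<subseteq> ?L"
  proof (rule mon_ideal_subset_ideal)
    show "ideal.subspace ?L"
      by (simp add: ideal_mult_def)
    fix e assume "e \<in> square_exps (parcs G)"
    then obtain a b c d where abcd: "(a, b) \<in> parcs G" "(c, d) \<in> parcs G"
      "\<forall>w. lookup (single a 1 + single b 1 + (single c 1 + single d 1)) w \<le> lookup e w"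
      by (auto simp: square_exps_def)
    then obtain e' where e: "e = single a 1 + single b 1 + (single c 1 + single d 1) + e'"
      unfolding mem_range_add_iff[symmetric] by blast
    have "var u * var v \<in> (edge_ideal G :: ('v, 'k) mpolynomial set)" if "(u, v) \<in> parcs G" for u v
      unfolding edge_ideal_def using that by (intro ideal.span_base) blast
    then have "(var a * var b) * (var c * var d) \<in> ?L"
      unfolding ideal_mult_def using abcd(1,2) by (intro ideal.span_base) blast
    then have "single e' 1 * ((var a * var b) * (var c * var d)) \<in> ?L"
      unfolding ideal_mult_def by (rule ideal.span_scale)
    also have "single e' 1 * ((var a * var b) * (var c * var d)) = (single e 1 :: ('v, 'k) mpolynomial)"
      unfolding e var_def by (simp only: mult_single mult_1 ac_simps)
    finally show "single e 1 \<in> ?L" .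
  qed
qed

lemma mon_ideal_nonzero_subset_irrelevant: "mon_ideal (- {0}) \<subseteq> irrelevant_ideal"
proof (rule mon_ideal_subset_ideal)
  fix e :: "'v \<Rightarrow>\<^sub>0 nat"
  assume "e \<in> - {0}"
  then obtain v where "lookup e v \<noteq> 0"
    by (metis ComplD lookup_zero poly_mapping_eqI singletonI)
  then have "\<forall>w. lookup (single v 1) w \<le> lookup e w"
    by (simp add: lookup_single when_def)
  then obtain e' where "e = single v 1 + e'"
    unfolding mem_range_add_iff[symmetric] by blast
  moreover have "single e' 1 * var v \<in> irrelevant_ideal"
    unfolding irrelevant_ideal_def by (intro ideal.span_scale ideal.span_base) simp
  ultimately show "single e 1 \<in> irrelevant_ideal"
    by (simp add: var_def mult_single add.commute)
qed (simp add: irrelevant_ideal_def)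

lemma depth_quot_ge:
  assumes fin: "finite (UNIV :: 'v set)" and "up_closed U" and "0 \<notin> U"
    and "weakly_regular (mon_ideal U :: ('v, 'k::field) mpolynomial set) (elem_syms r)"
  shows "enat r \<le> depth_quot irrelevant_ideal (mon_ideal U :: ('v, 'k) mpolynomial set)"
proof -
  let ?fs = "elem_syms r :: ('v, 'k) mpolynomial list"
  \<comment> \<open>The polynomials without constant term form a proper ideal that contains
    \<open>mon_ideal U\<close> and the sequence, which starts at \<open>elem_sym 1\<close> and so
    avoids \<open>elem_sym 0 = 1\<close>.\<close>
  let ?M = "mon_ideal (- {0}) :: ('v, 'k) mpolynomial set"
  have fs: "set ?fs \<subseteq> ?M"
  proof
    fix f assume "f \<in> set ?fs"
    then obtain j where "f = elem_sym j" "j \<noteq> 0"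
      by (auto simp: elem_syms_def)
    moreover have "mon_deg (0 :: 'v \<Rightarrow>\<^sub>0 nat) = 0"
      by (simp add: mon_deg_def)
    ultimately show "f \<in> ?M"
      using homogeneous_elem_sym[OF fin, of j] by (auto simp: homogeneous_def mon_ideal_def)
  qed
  have "up_closed (- {0 :: 'v \<Rightarrow>\<^sub>0 nat})"
    unfolding up_closed_def by (auto simp: poly_mapping_eq_iff lookup_add fun_eq_iff)
  then have "ideal_gen (mon_ideal U \<union> set ?fs) \<subseteq> ?M"
    using fs assms(3) by (intro ideal.span_minimal subspace_mon_ideal) (auto simp: mon_ideal_def)
  moreover have "1 \<notin> ?M"
    by (simp add: mon_ideal_def)
  ultimately have "ideal_gen (mon_ideal U \<union> set ?fs) \<noteq> UNIV"
    by blast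
  then have "regular_seq_quot (mon_ideal U) ?fs"
    by (rule regular_seq_quotI[rotated])
      (simp only: ideal_gen_subspace[OF subspace_mon_ideal[OF assms(2)]] assms(4))
  moreover have "set ?fs \<subseteq> irrelevant_ideal"
    using fs mon_ideal_nonzero_subset_irrelevant by blast
  moreover have "length ?fs = r"
    by (simp add: elem_syms_def)
  ultimately show ?thesis
    unfolding depth_quot_def by (intro Sup_upper CollectI exI[of _ ?fs]) simp
qed

section \<open>Packings in graphs\<close>

text \<open>The forbidden set lies in the window from its least element \<open>a\<close> to
  \<open>a + 3\<close>. Multiples of 3 are taken below the window and every third index from
  \<open>a + 4\<close> on above it; the gap across the window is at least 5.\<close>

lemma separated_indices_avoiding:
  fixes A :: "nat set"
  assumes A: "\<And>i j. i \<in> A \<Longrightarrow> j \<in> A \<Longrightarrow> j \<le> i + 3" and ne: "A \<noteq> {}"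
  shows "\<exists>I \<subseteq> {..d} - A. (\<forall>i \<in> I. \<forall>j \<in> I. i < j \<longrightarrow> i + 3 \<le> j) \<and> (d - 1) div 3 \<le> card I"
proof -
  define a where "a = (LEAST i. i \<in> A)"
  have a: "a \<in> A" and le_a: "\<And>i. i \<in> A \<Longrightarrow> a \<le> i"
    using ne unfolding a_def by (auto intro: LeastI Least_le)
  \<comment> \<open>\<open>a'\<close> keeps \<open>B\<close> within \<open>{..d}\<close> when
    \<open>a > d\<close>, and \<open>(a' + 2) div 3\<close> counts the multiples of 3 below it. The
    indices \<open>a + 4 + 3 * i \<le> d\<close> number \<open>(d - 1 - a) div 3\<close>, which
    truncated subtraction makes 0 for \<open>d \<le> a\<close>.\<close>
  define a' where "a' = min a (d + 1)"
  define B where "B = (\<lambda>i. 3 * i) ` {..<(a' + 2) div 3}"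
  define C where "C = (\<lambda>i. a + 4 + 3 * i) ` {..<(d - 1 - a) div 3}"
  have B: "i < a" "i \<le> d" "3 dvd i" if "i \<in> B" for i
    using that by (auto simp: B_def a'_def)
  have C: "a + 4 \<le> i" "i \<le> d" "3 dvd (i - (a + 4))" if "i \<in> C" for i
    using that by (auto simp: C_def)
  have sep: "i + 3 \<le> j" if "i < j" "3 dvd (j - i)" for i j :: nat
    using that dvd_imp_le[of 3 "j - i"] by simp
  have "card B = (a' + 2) div 3" "card C = (d - 1 - a) div 3"
    unfolding B_def C_def by (subst card_image; simp add: inj_on_def)+
  moreover have "B \<inter> C = {}" "finite B" "finite C"
  proof -
    show "B \<inter> C = {}"
    proof (rule ccontr)
      assume "B \<inter> C \<noteq> {}"
      then obtain i where "i \<in> B" "i \<in> C" by blast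
      with B(1)[of i] C(1)[of i] show False by simp
    qed
  qed (simp_all add: B_def C_def)
  ultimately have card: "card (B \<union> C) = (a' + 2) div 3 + (d - 1 - a) div 3"
    by (simp add: card_Un_disjoint)
  have "B \<union> C \<subseteq> {..d} - A"
  proof
    fix i assume "i \<in> B \<union> C"
    then consider "i < a \<and> i \<le> d" | "a + 4 \<le> i \<and> i \<le> d"
      using B(1,2) C(1,2) by blast
    then show "i \<in> {..d} - A"
      using A[OF a, of i] le_a[of i] by cases auto
  qed
  moreover have "i + 3 \<le> j" if ij: "i \<in> B \<union> C" "j \<in> B \<union> C" "i < j" for i j
  proof -
    consider "i \<in> B" "j \<in> B" | "i \<in> B" "j \<in> C" | "i \<in> C" "j \<in> B" | "i \<in> C" "j \<in> C"
      using ij by blast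
    then show ?thesis
    proof cases
      case 1
      then have "3 dvd (j - i)" using B(3) by (intro dvd_diff_nat)
      with ij(3) show ?thesis by (rule sep)
    next
      case 2 with B(1)[of i] C(1)[of j] show ?thesis by simp
    next
      case 3 with B(1)[of j] C(1)[of i] ij(3) show ?thesis by simp
    next
      case 4
      have "(j - (a + 4)) - (i - (a + 4)) = j - i"
        using C(1)[OF 4(1)] ij by simp
      with dvd_diff_nat[OF C(3)[OF 4(2)] C(3)[OF 4(1)]] have "3 dvd (j - i)" by simp
      with ij(3) show ?thesis by (rule sep)
    qed
  qed
  moreover have "(d - 1) div 3 \<le> card (B \<union> C)"
  proof (cases "a \<le> d + 1")
    case True
    have "d - 1 < ((a + 2) div 3 + (d - 1 - a) div 3 + 1) * 3"
      using dividend_less_div_times[of 3 "a + 2"] dividend_less_div_times[of 3 "d - 1 - a"] by simp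
    then have "(d - 1) div 3 \<le> (a + 2) div 3 + (d - 1 - a) div 3"
      using less_mult_imp_div_less by fastforce
    with True show ?thesis by (simp add: card a'_def)
  next
    case False
    have "(d - 1) div 3 \<le> (d + 3) div 3"
      by (rule div_le_mono) simp
    with False show ?thesis by (simp add: card a'_def)
  qed
  ultimately show ?thesis by blast
qed

lemma separated_indices:
  "\<exists>I \<subseteq> {..d}. (\<forall>i \<in> I. \<forall>j \<in> I. i < j \<longrightarrow> i + 3 \<le> j) \<and> card I = d div 3 + 1" for d :: nat
proof (intro exI conjI)
  show "card ((\<lambda>i. 3 * i) ` {..d div 3}) = d div 3 + 1"
    by (subst card_image) (simp_all add: inj_on_def)
qed auto

section \<open>Walks as powers of the edge relation\<close>

lemma relpow_sym: "sym E \<Longrightarrow> (a, b) \<in> E ^^ n \<Longrightarrow> (b, a) \<in> E ^^ n"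
proof (induction n arbitrary: a b)
  case (Suc n)
  then obtain c where "(a, c) \<in> E ^^ n" "(c, b) \<in> E" by auto
  then have "(b, c) \<in> E" "(c, a) \<in> E ^^ n"
    using Suc by (auto dest: symD)
  then show ?case by (rule relpow_Suc_I2)
qed simp

lemma relpow_closed:
  assumes "\<And>a b. a \<in> S \<Longrightarrow> (a, b) \<in> E \<Longrightarrow> b \<in> S" and "a \<in> S" and "(a, b) \<in> E ^^ n"
  shows "b \<in> S"
  using assms(3) by (induction n arbitrary: b) (auto intro: assms(1,2))

text \<open>A shortest walk from \<open>u\<close> to \<open>v\<close> has length at least
  \<open>d\<close> and all its segments are shortest; its first \<open>d\<close> steps serve. The
  bound on \<open>d\<close> has the one-sided form that \<open>graph_dist_scc_le\<close>
  provides.\<close>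

lemma geodesic_exists:
  assumes "(u, v) \<in> E\<^sup>*" and "\<And>n. (u, v) \<in> E ^^ n \<Longrightarrow> d \<le> n"
  shows "\<exists>f. f 0 = u \<and> (\<forall>i < d. (f i, f (Suc i)) \<in> E) \<and>
    (\<forall>i \<le> d. \<forall>j \<le> d. \<forall>n. (f i, f j) \<in> E ^^ n \<longrightarrow> j \<le> i + n)"
proof -
  define m where "m = (LEAST n. (u, v) \<in> E ^^ n)"
  obtain n where "(u, v) \<in> E ^^ n"
    using assms(1) by (meson rtrancl_imp_relpow)
  then have m: "(u, v) \<in> E ^^ m" and least: "\<And>n. (u, v) \<in> E ^^ n \<Longrightarrow> m \<le> n"
    unfolding m_def by (rule LeastI) (rule Least_le)
  have "d \<le> m" using assms(2) m by blast
  obtain f where f: "f 0 = u" "f m = v" "\<forall>i < m. (f i, f (Suc i)) \<in> E"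
    using m by (auto simp: relpow_fun_conv)
  have seg: "(f i, f (i + n)) \<in> E ^^ n" if "i + n \<le> m" for i n
    using that f(3) by (induction n) auto
  have "j \<le> i + n" if "i \<le> d" "j \<le> d" "(f i, f j) \<in> E ^^ n" for i j n
  proof -
    have "(u, f i) \<in> E ^^ i" "(f j, v) \<in> E ^^ (m - j)"
      using seg[of 0 i] seg[of j "m - j"] f(1,2) that(1,2) \<open>d \<le> m\<close> by auto
    then have "(u, v) \<in> E ^^ (i + n + (m - j))"
      using that(3) by (auto simp: relpow_add)
    then have "m \<le> i + n + (m - j)" by (rule least)
    then show ?thesis using that(2) \<open>d \<le> m\<close> by linarith
  qed
  then show ?thesis using f \<open>d \<le> m\<close> by (intro exI[of _ f]) auto
qed

lemma relpow_Image_clique: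
  assumes "sym E" and "\<And>k k'. k \<in> K \<Longrightarrow> k' \<in> K \<Longrightarrow> k = k' \<or> (k, k') \<in> E"
    and "z \<in> E `` K" and "z' \<in> E `` K"
  shows "\<exists>n \<le> 3. (z, z') \<in> E ^^ n"
proof -
  obtain k k' where k: "k \<in> K" "(z, k) \<in> E" "k' \<in> K" "(k', z') \<in> E"
    using assms(3,4) symD[OF assms(1)] by blast
  then consider "k = k'" | "(k, k') \<in> E" using assms(2) by blast
  then show ?thesis
  proof cases
    case 1
    with k have "(z, z') \<in> E ^^ 2" by (auto simp: numeral_2_eq_2)
    then show ?thesis by (intro exI[of _ 2]) simp
  next
    case 2
    with k have "(z, z') \<in> E ^^ 3" by (auto simp: numeral_3_eq_3)
    then show ?thesis by (intro exI[of _ 3]) simp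
  qed
qed

text \<open>\<open>Z\<close> lies in every component that it meets, hence meets at most one. If it
  meets the geodesic, it blocks at most four consecutive positions there, and the other components
  keep their representatives. Otherwise all \<open>d div 3 + 1\<close> chosen positions are
  available, and the extra one makes up for the at most one representative in
  \<open>Z\<close>.\<close>

lemma packing_exists:
  fixes E :: "'v rel"
  assumes sym: "sym E" and finP: "finite P" and disj: "disjoint P" and ne: "{} \<notin> P"
    and closed: "\<And>S a b. S \<in> P \<Longrightarrow> a \<in> S \<Longrightarrow> (a, b) \<in> E \<Longrightarrow> b \<in> S"
    and S0: "S0 \<in> P" "\<And>i. i \<le> d \<Longrightarrow> f i \<in> S0"
    and geo: "\<And>i j n. i \<le> d \<Longrightarrow> j \<le> d \<Longrightarrow> (f i, f j) \<in> E ^^ n \<Longrightarrow> j \<le> i + n"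
    and Z: "\<And>z z'. z \<in> Z \<Longrightarrow> z' \<in> Z \<Longrightarrow> \<exists>n \<le> 3. (z, z') \<in> E ^^ n"
  shows "\<exists>T. packing E T \<and> T \<inter> Z = {} \<and> (d - 1) div 3 + card P - 1 \<le> card T"
proof -
  define rep where "rep S = (SOME v. v \<in> S)" for S :: "'v set"
  have rep: "rep S \<in> S" if "S \<in> P" for S
    using that ne unfolding rep_def by (metis some_in_eq)
  have uniq: "S = S'" if "S \<in> P" "S' \<in> P" "v \<in> S" "v \<in> S'" for S S' v
    using disj that by (auto simp: disjoint_def pairwise_def disjnt_def)
  have Z_closed: "Z \<subseteq> S" if S: "S \<in> P" "S \<inter> Z \<noteq> {}" for S
  proof
    fix z' assume "z' \<in> Z"
    obtain z where "z \<in> S" "z \<in> Z" using S(2) by blast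
    moreover obtain n where "(z, z') \<in> E ^^ n"
      using Z[OF \<open>z \<in> Z\<close> \<open>z' \<in> Z\<close>] by blast
    ultimately show "z' \<in> S"
      using relpow_closed[of S E z z' n, OF closed[OF S(1)]] by simp
  qed
  have packs: "packing E (f ` I \<union> rep ` Q) \<and> card (f ` I \<union> rep ` Q) = card I + card Q"
    if I: "I \<subseteq> {..d}" "\<And>i j. i \<in> I \<Longrightarrow> j \<in> I \<Longrightarrow> i < j \<Longrightarrow> i + 3 \<le> j" and Q: "Q \<subseteq> P - {S0}" for I Q
  proof
    have far: "i = j" if "i \<in> I" "j \<in> I" "(f i, f j) \<in> E ^^ n" "n \<le> 2" for i j n
    proof -
      have "j \<le> i + n" "i \<le> j + n"
        using geo[of i j n] geo[of j i n] relpow_sym[OF sym that(3)] that(1-3) I(1) by auto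
      with I(2)[OF that(1,2)] I(2)[OF that(2,1)] that(4) show ?thesis by linarith
    qed
    define comp where "comp t = (THE S. S \<in> P \<and> t \<in> S)" for t
    have comp: "comp t = S" if "S \<in> P" "t \<in> S" for S t
      unfolding comp_def using that uniq by (intro the_equality) blast+
    have comp_f: "comp (f i) = S0" if "i \<in> I" for i
      using that I(1) S0 by (intro comp) auto
    have comp_rep: "comp (rep S) = S" if "S \<in> Q" for S
      using that Q rep by (intro comp) auto
    have inP: "\<exists>S \<in> P. t \<in> S" if "t \<in> f ` I \<union> rep ` Q" for t
      using that I(1) S0 Q rep by blast
    have comp_E: "comp t = comp t'" if "t \<in> f ` I \<union> rep ` Q" "(t, t') \<in> E" for t t'
      using inP[OF that(1)] comp closed that(2) by metis
    \<comment> \<open>Adjacency and a common neighbour are walks of length 1 and 2 within one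
      component, so this fact gives both packing conditions.\<close>
    have eq: "t = t'" if t: "t \<in> f ` I \<union> rep ` Q" "t' \<in> f ` I \<union> rep ` Q"
      and n: "(t, t') \<in> E ^^ n" "n \<le> 2" and c: "comp t = comp t'" for t t' n
    proof -
      consider i j where "i \<in> I" "j \<in> I" "t = f i" "t' = f j"
        | S S' where "S \<in> Q" "S' \<in> Q" "t = rep S" "t' = rep S'"
        | "comp t = S0 \<and> comp t' \<in> Q \<or> comp t \<in> Q \<and> comp t' = S0"
        using t comp_f comp_rep by auto
      then show ?thesis
      proof cases
        case 1 then show ?thesis using far n by blast
      next
        case 2 then show ?thesis using c comp_rep by metis
      next
        case 3 then show ?thesis using c Q by auto
      qed
    qed
    show "packing E (f ` I \<union> rep ` Q)"
      unfolding packing_def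
    proof (intro ballI impI conjI allI notI)
      fix t t' assume t: "t \<in> f ` I \<union> rep ` Q" "t' \<in> f ` I \<union> rep ` Q" and "t \<noteq> t'"
      {
        assume "(t, t') \<in> E"
        then show False
          using eq[OF t, of 1] comp_E[OF t(1)] \<open>t \<noteq> t'\<close> by simp
      next
        fix c assume c: "(t, c) \<in> E" "(t', c) \<in> E"
        then have "(t, t') \<in> E ^^ 2"
          using symD[OF sym c(2)] by (auto simp: numeral_2_eq_2)
        then show False
          using eq[OF t, of 2] comp_E[OF t(1) c(1)] comp_E[OF t(2) c(2)] \<open>t \<noteq> t'\<close> by simp
      }
    qed
    have "inj_on f I"
    proof (rule inj_onI)
      fix i j assume "i \<in> I" "j \<in> I" "f i = f j"
      then show "i = j" using far[of i j 0] by simp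
    qed
    moreover have "inj_on rep Q"
      using comp_rep by (intro inj_on_inverseI)
    moreover have "f ` I \<inter> rep ` Q = {}"
      using comp_f comp_rep Q by force
    moreover have "finite I" "finite Q"
      using I(1) Q finP by (auto intro: finite_subset)
    ultimately show "card (f ` I \<union> rep ` Q) = card I + card Q"
      by (simp add: card_Un_disjoint card_image)
  qed
  have card_P: "card (P - {S0}) = card P - 1"
    using S0(1) finP by simp
  show ?thesis
  proof (cases "{i. i \<le> d \<and> f i \<in> Z} = {}")
    case False
    have "j \<le> i + 3" if "i \<le> d" "f i \<in> Z" "j \<le> d" "f j \<in> Z" for i j
      using Z[OF that(2,4)] geo[OF that(1,3)] by force
    then obtain I where I: "I \<subseteq> {..d} - {i. i \<le> d \<and> f i \<in> Z}"
      "\<forall>i \<in> I. \<forall>j \<in> I. i < j \<longrightarrow> i + 3 \<le> j" "(d - 1) div 3 \<le> card I"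
      using separated_indices_avoiding[of "{i. i \<le> d \<and> f i \<in> Z}" d] False by blast
    have "Z \<subseteq> S0"
      using False S0 by (intro Z_closed) auto
    then have "rep S \<notin> Z" if "S \<in> P - {S0}" for S
      using that rep uniq S0(1) by blast
    with I(1) have "(f ` I \<union> rep ` (P - {S0})) \<inter> Z = {}" by auto
    moreover have "(d - 1) div 3 + card P - 1 \<le> card I + card (P - {S0})"
      using I(3) card_P by linarith
    moreover have "I \<subseteq> {..d}" using I(1) by blast
    ultimately show ?thesis
      using packs[of I "P - {S0}"] I(2) by (intro exI[of _ "f ` I \<union> rep ` (P - {S0})"]) auto
  next
    case True
    obtain I where I: "I \<subseteq> {..d}" "\<forall>i \<in> I. \<forall>j \<in> I. i < j \<longrightarrow> i + 3 \<le> j" "card I = d div 3 + 1"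
      using separated_indices by blast
    define Q where "Q = {S \<in> P - {S0}. rep S \<notin> Z}"
    \<comment> \<open>\<open>S1\<close> is the component whose representative lies in
      \<open>Z\<close>, and arbitrary if there is none.\<close>
    have "\<exists>S1. P - {S0} \<subseteq> insert S1 Q"
    proof (cases "\<exists>S1 \<in> P. rep S1 \<in> Z")
      case True
      then obtain S1 where S1: "S1 \<in> P" "rep S1 \<in> Z" by blast
      have "S = S1" if "S \<in> P" "rep S \<in> Z" for S
        using Z_closed[of S1] S1 rep that uniq by blast
      then show ?thesis unfolding Q_def by blast
    qed (auto simp: Q_def)
    then obtain S1 where S1: "P - {S0} \<subseteq> insert S1 Q" by blast
    have "finite Q" using finP by (simp add: Q_def)
    then have "card (P - {S0}) \<le> card (insert S1 Q)"
      using S1 by (intro card_mono) simp_all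
    also have "\<dots> \<le> Suc (card Q)"
      using \<open>finite Q\<close> by (simp add: card_insert_if)
    finally have "(d - 1) div 3 + card P - 1 \<le> card I + card Q"
      using I(3) card_P div_le_mono[of "d - 1" d 3] by linarith
    moreover have "(f ` I \<union> rep ` Q) \<inter> Z = {}"
      using True I(1) by (auto simp: Q_def)
    moreover have "Q \<subseteq> P - {S0}" by (auto simp: Q_def)
    ultimately show ?thesis
      using packs[of I Q] I(1,2) by (intro exI[of _ "f ` I \<union> rep ` Q"]) auto
  qed
qed

section \<open>Components and diameter of the graph\<close>

context pair_graph
begin

lemma sccs_verts_closed:
  assumes "S \<in> sccs_verts" and "a \<in> S" and "(a, b) \<in> parcs G"
  shows "b \<in> S"
proof -
  have "a \<rightarrow>\<^sup>*\<^bsub>with_proj G\<^esub> b" "b \<rightarrow>\<^sup>*\<^bsub>with_proj G\<^esub> a"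
    using assms(3) arcs_symmetric by (auto intro!: reachable_adjI)
  with assms(1,2) show ?thesis
    unfolding in_sccs_verts_conv_reachable by blast
qed

lemma walk_in_scc:
  assumes S: "S \<in> sccs_verts" and "u \<in> S" and "(u, v) \<in> parcs G ^^ n"
  shows "\<exists>p. pre_digraph.awalk (with_proj G \<restriction> S) u p v \<and> length p = n"
proof -
  interpret H: wf_digraph "with_proj G \<restriction> S"
    by (rule wellformed_induce_subgraph)
  show ?thesis
    using assms(2,3)
  proof (induction n arbitrary: u)
    case 0
    then show ?case by (simp add: H.awalk_Nil_iff)
  next
    case (Suc n)
    then obtain w where w: "(u, w) \<in> parcs G" "(w, v) \<in> parcs G ^^ n"
      by (meson relpow_Suc_D2)
    have "w \<in> S"
      using sccs_verts_closed[OF S] Suc.prems(1) w(1) by blast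
    with Suc.IH w(2) obtain p where "H.awalk w p v" "length p = n" by blast
    with w(1) \<open>u \<in> S\<close> \<open>w \<in> S\<close> show ?case
      by (intro exI[of _ "(u, w) # p"]) (simp add: H.awalk_Cons_iff)
  qed
qed

text \<open>Walks from \<open>S\<close> stay in \<open>S\<close>, so they also bound the distance in
  the induced component; as \<open>graph_dist\<close> ranges over paths, cycles are cut out
  first.\<close>

lemma graph_dist_scc_le:
  assumes "S \<in> sccs_verts" and "u \<in> S" and "(u, v) \<in> parcs G ^^ n"
  shows "graph_dist (with_proj G \<restriction> S) u v \<le> n"
proof -
  interpret H: wf_digraph "with_proj G \<restriction> S"
    by (rule wellformed_induce_subgraph)
  obtain p where p: "H.awalk u p v" "length p = n"
    using walk_in_scc[OF assms] by blast
  \<comment> \<open>With unit costs, the cost bound for cutting out cycles becomes a bound on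
    length.\<close>
  have cost: "awalk_cost (\<lambda>_. 1) q = real (length q)" for q :: "('a \<times> 'a) list"
    by (simp add: awalk_cost_def sum_list_triv)
  have "awalk_cost (\<lambda>_. 1) (H.awalk_to_apath p) \<le> awalk_cost (\<lambda>_. 1) p"
    by (rule H.awalk_to_path_no_neg_cyc_cost[OF p(1)]) (simp add: cost)
  then have "length (H.awalk_to_apath p) \<le> n"
    using p(2) by (simp add: cost)
  moreover have "graph_dist (with_proj G \<restriction> S) u v \<le> length (H.awalk_to_apath p)"
    unfolding graph_dist_def using H.apath_awalk_to_apath[OF p(1)] by (blast intro: Least_le)
  ultimately show ?thesis by simp
qed

lemma graph_diameter_attained:
  assumes "pverts G \<noteq> {}"
  obtains S u v where "S \<in> sccs_verts" "u \<in> S" "v \<in> S"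
    "graph_diameter (with_proj G) = graph_dist (with_proj G \<restriction> S) u v"
proof -
  have "finite sccs" "sccs \<noteq> {}"
    using finite_sccs_verts exists_scc assms by (auto simp: sccs_conv_sccs_verts)
  then have "graph_diameter (with_proj G) \<in> connected_diameter ` sccs"
    unfolding graph_diameter_def by (intro Max_in) simp_all
  then obtain S where S: "S \<in> sccs_verts"
    "graph_diameter (with_proj G) = connected_diameter (with_proj G \<restriction> S)"
    by (auto simp: sccs_conv_sccs_verts)
  let ?D = "(\<lambda>(u, v). graph_dist (with_proj G \<restriction> S) u v) ` (S \<times> S)"
  have "finite S" "S \<noteq> {}"
    using S(1) sccs_verts_subsets[OF S(1)] pair_finite_verts
    by (auto simp: in_sccs_verts_conv_reachable intro: finite_subset)
  then have "Max ?D \<in> ?D"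
    by (intro Max_in) auto
  moreover have "connected_diameter (with_proj G \<restriction> S) = Max ?D"
    unfolding connected_diameter_def by (rule arg_cong[of _ _ Max]) auto
  ultimately show ?thesis
    using that S by auto
qed

text \<open>Used with \<open>K\<close> empty, an edge, or a triangle. Two neighbours of such a
  clique are joined by a walk of length at most 3 through \<open>K\<close>, as
  \<open>packing_exists\<close> demands.\<close>

lemma packing_avoiding_clique_neighbourhood:
  assumes "pverts G \<noteq> {}" and K: "\<And>k k'. k \<in> K \<Longrightarrow> k' \<in> K \<Longrightarrow> k = k' \<or> (k, k') \<in> parcs G"
  shows "\<exists>T. packing (parcs G) T \<and> T \<inter> parcs G `` K = {} \<and>
    (graph_diameter (with_proj G) - 1) div 3 + card sccs - 1 \<le> card T"
proof -
  let ?d = "graph_diameter (with_proj G)"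
  have sym: "sym (parcs G)"
    using arcs_symmetric by (auto intro: symI)
  obtain S u v where S: "S \<in> sccs_verts" "u \<in> S" "v \<in> S" "?d = graph_dist (with_proj G \<restriction> S) u v"
    using graph_diameter_attained[OF assms(1)] by blast
  have "u \<rightarrow>\<^sup>*\<^bsub>with_proj G\<^esub> v"
    using S by (auto simp: in_sccs_verts_conv_reachable)
  from reachable_rtranclI[OF this] have "(u, v) \<in> (parcs G)\<^sup>*"
    by simp
  moreover have "?d \<le> n" if "(u, v) \<in> parcs G ^^ n" for n
    using graph_dist_scc_le[OF S(1,2) that] S(4) by simp
  ultimately obtain f where f: "f 0 = u" "\<forall>i < ?d. (f i, f (Suc i)) \<in> parcs G"
    "\<forall>i \<le> ?d. \<forall>j \<le> ?d. \<forall>n. (f i, f j) \<in> parcs G ^^ n \<longrightarrow> j \<le> i + n"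
    using geodesic_exists[of u v "parcs G" ?d] by blast
  have fS: "f i \<in> S" if "i \<le> ?d" for i
    using that
  proof (induction i)
    case (Suc i)
    then show ?case
      using sccs_verts_closed[OF S(1), of "f i"] f(2) by simp
  qed (simp add: f(1) S(2))
  have "disjoint sccs_verts"
    using sccs_verts_disjoint by (auto intro: disjointI)
  moreover have "{} \<notin> sccs_verts"
    by (simp add: in_sccs_verts_conv_reachable)
  moreover have "\<exists>n \<le> 3. (z, z') \<in> parcs G ^^ n" if "z \<in> parcs G `` K" "z' \<in> parcs G `` K" for z z'
    by (rule relpow_Image_clique[OF sym K that])
  ultimately have "\<exists>T. packing (parcs G) T \<and> T \<inter> parcs G `` K = {} \<and> (?d - 1) div 3 + card sccs_verts - 1 \<le> card T"
    using f(3) fS sccs_verts_closed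
    by (intro packing_exists[OF sym finite_sccs_verts _ _ _ S(1), where f = f]) blast+
  then show ?thesis
    by (simp add: card_sccs_verts)
qed

end

theorem theorem4p4:
  fixes G :: "'v pair_pre_digraph"
    and I :: "('v, 'k::field) mpolynomial set"
    and d p :: nat
  assumes "pair_graph G"
    and "pverts G = UNIV"
    and "no_isolated_verts G"
    and "I = edge_ideal G"
    and "d = graph_diameter (with_proj G)"
    and "p = card (pre_digraph.sccs (with_proj G))"
  shows "ereal_of_enat (depth_quot irrelevant_ideal (ideal_mult I I))
           \<ge> ereal (real_of_int (\<lceil>(real d - 3) / 3\<rceil> + int p - 1))"
proof -
  interpret pair_graph G by fact
  define E where "E = parcs G"
  \<comment> \<open>\<open>(d - 1) div 3\<close> is the ceiling of \<open>(d - 3) / 3\<close> for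
    \<open>d \<ge> 1\<close>; for \<open>d = 0\<close> it is 0 instead of -1, still an upper
    bound.\<close>
  define r where "r = (d - 1) div 3 + p - 1"
  have fin: "finite (UNIV :: 'v set)"
    using pair_finite_verts assms(2) by simp
  have sym: "sym E"
    using arcs_symmetric by (auto simp: E_def intro: symI)
  have irrefl: "irrefl E"
    using no_loops' by (auto simp: E_def irrefl_def)
  have pack: "\<exists>T. packing E T \<and> T \<inter> E `` K = {} \<and> r \<le> card T"
    if "\<And>k k'. k \<in> K \<Longrightarrow> k' \<in> K \<Longrightarrow> k = k' \<or> (k, k') \<in> E" for K
    using packing_avoiding_clique_neighbourhood[of K] that assms(2,5,6) by (simp add: E_def r_def)
  have "weakly_regular (mon_ideal (square_exps E \<union> edge_exps {}))
      (elem_syms r :: ('v, 'k) mpolynomial list)"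
  proof (rule weakly_regular_square_exps[OF fin sym irrefl])
    show "\<exists>T. packing E T \<and> r \<le> card T"
      using pack[of "{}"] by auto
    show "\<exists>T. packing E T \<and> T \<inter> (E `` {x} \<union> E `` {y}) = {} \<and> r \<le> card T"
      if "(x, y) \<in> E" for x y
    proof -
      have "E `` {x} \<union> E `` {y} = E `` {x, y}" by blast
      then show ?thesis
        using pack[of "{x, y}"] that symD[OF sym that] by auto
    qed
    show "\<exists>T. packing E T \<and> T \<inter> (E `` {x} \<union> E `` {y} \<union> E `` {a}) = {} \<and> r \<le> card T"
      if "(x, y) \<in> E" "a \<in> E `` {x} \<inter> E `` {y}" for x y a
    proof -
      have "E `` {x} \<union> E `` {y} \<union> E `` {a} = E `` {x, y, a}" by blast
      \<comment> \<open>A common neighbour of \<open>x\<close> and \<open>y\<close> completes the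
        edge to a triangle.\<close>
      moreover have "k = k' \<or> (k, k') \<in> E" if "k \<in> {x, y, a}" "k' \<in> {x, y, a}" for k k'
        using that \<open>(x, y) \<in> E\<close> \<open>a \<in> E `` {x} \<inter> E `` {y}\<close> symD[OF sym] by blast
      ultimately show ?thesis
        using pack[of "{x, y, a}"] by simp
    qed
  qed (simp_all add: sym_def)
  then have "weakly_regular (mon_ideal (square_exps E)) (elem_syms r :: ('v, 'k) mpolynomial list)"
    by (simp add: edge_exps_def)
  moreover have "0 \<notin> square_exps E"
  proof
    assume "0 \<in> square_exps E"
    then obtain a b c e where
      "\<forall>w. lookup (single a 1 + single b 1 + (single c 1 + single e 1)) w \<le> lookup (0 :: 'v \<Rightarrow>\<^sub>0 nat) w"
      unfolding square_exps_def by blast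
    from this[THEN spec, of a] show False by (simp add: lookup_add)
  qed
  ultimately have "enat r \<le> depth_quot irrelevant_ideal (mon_ideal (square_exps E) :: ('v, 'k) mpolynomial set)"
    by (intro depth_quot_ge[OF fin up_closed_square_exps'])
  then have depth: "enat r \<le> depth_quot irrelevant_ideal (ideal_mult I I)"
    by (simp add: assms(4) ideal_mult_edge_ideal E_def)
  have "sccs \<noteq> {}" "finite sccs"
    using finite_sccs_verts exists_scc assms(2) by (auto simp: sccs_conv_sccs_verts)
  \<comment> \<open>Thus the truncated subtraction of 1 in \<open>r\<close> agrees with the integer
    one.\<close>
  then have "p \<ge> 1"
    using assms(6) by (simp add: Suc_le_eq card_gt_0_iff)
  have "d \<le> 3 * ((d - 1) div 3) + 3"
    using dividend_less_div_times[of 3 "d - 1"] by simp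
  then have "real d \<le> 3 * real ((d - 1) div 3) + 3"
    by linarith
  then have "\<lceil>(real d - 3) / 3\<rceil> \<le> int ((d - 1) div 3)"
    by (simp add: ceiling_le_iff)
  then have "\<lceil>(real d - 3) / 3\<rceil> + int p - 1 \<le> int r"
    using \<open>p \<ge> 1\<close> by (simp add: r_def)
  then have "ereal (real_of_int (\<lceil>(real d - 3) / 3\<rceil> + int p - 1)) \<le> ereal_of_enat (enat r)"
    by simp
  also have "\<dots> \<le> ereal_of_enat (depth_quot irrelevant_ideal (ideal_mult I I))"
    using depth by (simp only: ereal_of_enat_le_iff)
  finally show ?thesis .
qed

end
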